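(* Let $-3<\gamma\le2$ and let $k>\max\{3,3+\gamma\}$ be a constant. Then for all $v\in\mathbb{R}^3$, $$I:=\int_{\mathbb{R}^3}\int_{\mathbb{S}^2}|v-v_*|^\gamma\frac{\langle v\rangle^k}{\langle v'\rangle^k\langle v'_*\rangle^k}\,d\sigma dv_*\le C_k\langle v\rangle^\gamma .$$ In fact, for $\gamma\in[0,1]$ the stronger estimate $$I\le\frac ck\langle v\rangle^\gamma+C_k\langle v\rangle^{\gamma-2}$$ holds for all $v\in\mathbb{R}^3$, for some constants $c>0$ and $C_k>0$.
   Context: $\langle v\rangle=(1+|v|^2)^{1/2}$; for $v,v_*\in\mathbb{R}^3$, $\sigma\in\mathbb{S}^2$: $v'=\frac{v+v_*}{2}+\frac{|v-v_*|}{2}\sigma$, $v'_*=\frac{v+v_*}{2}-\frac{|v-v_*|}{2}\sigma$. $C_k$ denotes a positive constant depending on $k$ (and $\gamma$); constants do not depend on $v$.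
   Formalization: In the stronger estimate c is independent of k and γ only over k≥k₀, for each fixed k₀>3 (c depends on k₀); a single c for all k>3 is impossible at γ=0, since I grows like 1/(k−3) for large |v| as k→3. *)

theory Defs
  imports "HOL-Analysis.Analysis"
begin

(* HOL-Analysis has no surface measure on spheres.  The one below is the measure d sigma of
   polar coordinates dx = r^(d-1) dr d sigma(x / r): the area of A is d times the volume of the
   cone over A in the unit ball.  The origin is removed because it has no direction. *)
definition sphere_measure :: "'a::euclidean_space measure" where
  "sphere_measure =
     scale_measure (of_nat DIM('a))
       (distr (restrict_space lborel (ball 0 1 - {0})) (restrict_space borel (sphere 0 1))
          (\<lambda>x. x /\<^sub>R norm x))"

lemma space_sphere_measure [simp]: "space sphere_measure = sphere 0 1"
  by (simp add: sphere_measure_def space_scale_measure space_restrict_space)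

lemma sets_sphere_measure [measurable_cong]:
  "sets sphere_measure = sets (restrict_space borel (sphere 0 1))"
  by (simp add: sphere_measure_def)

lemma measurable_direction:
  "(\<lambda>x::'a::euclidean_space. x /\<^sub>R norm x) \<in>
     restrict_space lborel (ball 0 1 - {0}) \<rightarrow>\<^sub>M restrict_space borel (sphere 0 1)"
  by (rule measurable_restrict_space2)
     (auto simp: space_restrict_space intro!: measurable_restrict_space1)

lemma emeasure_sphere_measure:
  fixes A :: "'a::euclidean_space set"
  assumes "A \<in> sets borel" "A \<subseteq> sphere 0 1"
  shows "emeasure sphere_measure A =
           of_nat DIM('a) * emeasure lborel {x \<in> ball 0 1 - {0}. x /\<^sub>R norm x \<in> A}"
proof -
  let ?B = "ball 0 1 - {0} :: 'a set"
  have A: "A \<in> sets (restrict_space borel (sphere 0 1))"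
    using assms by (simp add: sets_restrict_space_iff)
  have "emeasure (restrict_space lborel ?B)
          ((\<lambda>x. x /\<^sub>R norm x) -` A \<inter> space (restrict_space lborel ?B)) =
        emeasure lborel {x \<in> ?B. x /\<^sub>R norm x \<in> A}"
    by (subst emeasure_restrict_space)
       (auto simp: space_restrict_space intro!: arg_cong2[where f = emeasure])
  then show ?thesis
    unfolding sphere_measure_def
    by (simp add: emeasure_distr[OF measurable_direction A])
qed

lemma emeasure_sphere_measure_total:
  "emeasure (sphere_measure :: (real^3) measure) (sphere 0 1) = ennreal (4 * pi)"
proof -
  have "{x \<in> ball 0 1 - {0}. x /\<^sub>R norm x \<in> sphere 0 1} = ball (0::real^3) 1 - {0}"
    by auto
  moreover have "emeasure lborel (ball (0::real^3) 1 - {0}) = emeasure lborel (ball (0::real^3) 1)"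
    by (rule emeasure_Diff_null_set) auto
  ultimately show ?thesis
    by (simp add: emeasure_sphere_measure emeasure_ball unit_ball_vol_3 ennreal_mult'[symmetric]
        flip: ennreal_numeral)
qed

lemma emeasure_sphere_measure_rotation:
  fixes A :: "(real^3) set" and T :: "real^3 \<Rightarrow> real^3"
  assumes T: "orthogonal_transformation T" and A: "A \<in> sets borel" "A \<subseteq> sphere 0 1"
  shows "emeasure sphere_measure (T ` A) = emeasure sphere_measure A"
proof -
  let ?cone = "\<lambda>A. {x \<in> ball 0 1 - {0}. x /\<^sub>R norm x \<in> A} :: (real^3) set"
  have lin: "linear T" and inj: "inj T" and norm: "\<And>x. norm (T x) = norm x"
    using T by (auto simp: orthogonal_transformation_linear orthogonal_transformation_inj
        orthogonal_transformation_norm)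
  obtain S where S: "orthogonal_transformation S" "\<And>x. S (T x) = x" "\<And>x. T (S x) = x"
    using T orthogonal_transformation_inv orthogonal_transformation_surj[of T] inj
    by (metis inv_f_f surj_f_inv_f)
  have meas_S: "S \<in> borel_measurable borel"
    using S(1) by (intro borel_measurable_continuous_onI linear_continuous_on)
      (simp add: linear_conv_bounded_linear[symmetric] orthogonal_transformation_linear)
  have "T ` A = S -` A \<inter> space borel"
    using S by (auto simp: image_iff) metis
  then have TA_meas: "T ` A \<in> sets borel"
    using measurable_sets[OF meas_S A(1)] by simp
  have TA_sub: "T ` A \<subseteq> sphere 0 1"
    using A(2) by (auto simp: norm)
  have cone_meas: "?cone B \<in> sets borel" if "B \<in> sets borel" for B
  proof -
    have "?cone B = (ball 0 1 - {0}) \<inter> ((\<lambda>x. x /\<^sub>R norm x) -` B \<inter> space borel)"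
      by auto
    also have "\<dots> \<in> sets borel"
      by (intro sets.Int measurable_sets[OF _ that]) measurable
    finally show ?thesis .
  qed
  have T_sgn: "T x /\<^sub>R norm (T x) = T (x /\<^sub>R norm x)" for x
    by (simp only: norm linear_scale[OF lin])
  have T_0: "T x = 0 \<longleftrightarrow> x = 0" for x
    by (metis norm norm_eq_zero)
  have T_cone: "T x \<in> ?cone (T ` A) \<longleftrightarrow> x \<in> ?cone A" for x
    by (simp only: mem_Collect_eq T_sgn Diff_iff mem_ball_0 singleton_iff T_0
        inj_image_mem_iff[OF inj]) (simp only: norm)
  have img: "?cone (T ` A) = T ` ?cone A"
  proof (rule set_eqI)
    fix x
    have "x \<in> ?cone (T ` A) \<longleftrightarrow> S x \<in> ?cone A"
      using T_cone[of "S x"] by (simp only: S(3))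
    also have "\<dots> \<longleftrightarrow> x \<in> T ` ?cone A"
      using inj_image_mem_iff[OF inj, of "S x" "?cone A"] by (simp only: S(3))
    finally show "x \<in> ?cone (T ` A) \<longleftrightarrow> x \<in> T ` ?cone A" .
  qed
  have "?cone A \<subseteq> ball 0 1"
    by blast
  then have lm: "?cone A \<in> lmeasurable"
    by (intro fmeasurableI2[OF lmeasurable_ball[of 0 1]] sets_completionI_sets)
       (simp_all only: sets_lborel cone_meas[OF A(1)])
  have "emeasure lebesgue (T ` ?cone A) = emeasure lebesgue (?cone A)"
    by (simp only: emeasure_eq_measure2[OF lm] measure_orthogonal_image[OF T lm]
        emeasure_eq_measure2[OF measurable_orthogonal_image[OF T lm]])
  then have "emeasure lborel (?cone (T ` A)) = emeasure lborel (?cone A)"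
    using cone_meas[OF A(1)] cone_meas[OF TA_meas]
    by (simp only: img[symmetric] emeasure_completion main_part sets_lborel
        sets_completionI_sets)
  then show ?thesis
    by (simp only: emeasure_sphere_measure[OF A] emeasure_sphere_measure[OF TA_meas TA_sub])
qed

definition jbracket :: "real^3 \<Rightarrow> real"  (\<open>\<langle>_\<rangle>\<close>) where
  "\<langle>v\<rangle> = (1 + (norm v)\<^sup>2) powr (1/2)"

definition post_v :: "real^3 \<Rightarrow> real^3 \<Rightarrow> real^3 \<Rightarrow> real^3" where
  "post_v v w \<sigma> = (1/2) *\<^sub>R (v + w) + (norm (v - w) / 2) *\<^sub>R \<sigma>"

definition post_w :: "real^3 \<Rightarrow> real^3 \<Rightarrow> real^3 \<Rightarrow> real^3" where
  "post_w v w \<sigma> = (1/2) *\<^sub>R (v + w) - (norm (v - w) / 2) *\<^sub>R \<sigma>"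

(* An integral with values in [0, \<infinity>], so that an upper bound by a real number includes
   convergence.  The convention 0 powr \<gamma> = 0 only matters on the null set w = v. *)
definition collision_integral :: "real \<Rightarrow> real \<Rightarrow> real^3 \<Rightarrow> ennreal" where
  "collision_integral \<gamma> k v =
     (\<integral>\<^sup>+ w. (\<integral>\<^sup>+ \<sigma>. ennreal (norm (v - w) powr \<gamma> *
         (\<langle>v\<rangle> powr k / (\<langle>post_v v w \<sigma>\<rangle> powr k * \<langle>post_w v w \<sigma>\<rangle> powr k)))
       \<partial>sphere_measure) \<partial>lborel)"

end

theory Submission
  imports Defs
begin

text \<open>
  Fix \<open>v\<close> and \<open>w\<close>, and let \<open>e\<close> be the direction of \<open>v + w\<close>. The squared product of the two
  post-collisional brackets, divided by \<open>\<langle>v\<rangle>\<^sup>2\<close>, is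
  \<open>X + (Z - X) (1 - (\<sigma> \<bullet> e)\<^sup>2)\<close>, where \<open>X\<close> (\<open>post_min\<close>) and \<open>Z\<close> (\<open>post_max\<close>) are
  explicit functions of \<open>v\<close> and \<open>w\<close> (lemma \<open>post_product\<close>). The weight in the collision integral is
  the power \<open>- k / 2\<close> of this quantity. Two facts then give the theorem.

  Averaging over \<open>\<sigma>\<close> gains one power. With \<open>p = k / 2\<close>, the integral of
  \<open>(X + (Z - X) t) powr - p\<close> over \<open>t \<ge> 0\<close> is \<open>X powr (1 - p) / ((p - 1) (Z - X))\<close>, which controls the
  spherical integral unless \<open>Z\<close> and \<open>X\<close> are comparable; in that case the trivial bound by
  \<open>X powr - p\<close> is as good. So the spherical integral is at most a constant times
  \<open>X powr (1 - p) / Z\<close> (lemma \<open>sphere_kernel_bound_max\<close>). The factor \<open>1 / (p - 1)\<close> is where the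
  decay \<open>c / k\<close> comes from. The trivial bound lacks it, but if \<open>Z \<ge> 4\<close>, it is used only for
  \<open>X \<ge> 2\<close>, where \<open>X powr - p\<close> decays exponentially in \<open>p\<close> (lemma \<open>sphere_kernel_bound_uniform\<close>).
  In that uniform bound the power of \<open>X\<close> is kept at the value belonging to \<open>k\<^sub>0\<close>, so that the
  remaining integral over \<open>w\<close> does not depend on \<open>k\<close>.

  In cylindrical coordinates about \<open>v\<close>, writing \<open>u\<close> for the component of \<open>w\<close> along \<open>v\<close> and \<open>t\<close> for
  the squared length of the transverse part, \<open>X = 1 + u\<^sup>2 + t / \<langle>v\<rangle>\<^sup>2\<close> exactly, and \<open>Z\<close> is at least
  \<open>\<langle>v\<rangle>\<^sup>2 (1 + \<bar>w\<bar>\<^sup>2 / \<langle>v\<rangle>\<^sup>2)\<^sup>2 / 4\<close>. Integrating in \<open>u\<close> costs a constant as soon as \<open>2 (p - 1) > 1\<close>, that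
  is \<open>k > 3\<close>; integrating in \<open>t\<close> produces an area of order \<open>\<langle>v\<rangle>\<^sup>2\<close>, which is cancelled by \<open>1 / Z\<close>.
  The factor \<open>\<bar>v - w\<bar> powr \<gamma>\<close> costs \<open>\<langle>v\<rangle> powr \<gamma>\<close>, up to a power of \<open>1 + \<bar>w\<bar>\<^sup>2 / \<langle>v\<rangle>\<^sup>2\<close> that \<open>1 / Z\<close>
  absorbs together with a small part of the power of \<open>X\<close>. For negative \<open>\<gamma>\<close> the ball \<open>\<bar>v - w\<bar> \<le> \<langle>v\<rangle> / 4\<close> is treated apart: there \<open>X\<close> is at least of
  order \<open>\<langle>v\<rangle>\<^sup>2\<close>, and the local singularity is integrable because \<open>\<gamma> > -3\<close>.

  For the refined estimate, \<open>Z \<ge> 4\<close> holds for all \<open>w\<close> when \<open>\<langle>v\<rangle> \<ge> 4\<close>, and then the term with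
  \<open>c / k\<close> suffices; for \<open>\<langle>v\<rangle> < 4\<close> the powers \<open>\<langle>v\<rangle> powr \<gamma>\<close> and \<open>\<langle>v\<rangle> powr (\<gamma> - 2)\<close> are comparable, and
  the first estimate suffices.
\<close>


section \<open>Radial and cylindrical integration\<close>

text \<open>
  The function \<open>norm x ^ DIM('a)\<close> pushes Lebesgue measure forward to a multiple of
  one-dimensional Lebesgue measure on the half-line, since the ball on which it is at most \<open>c\<close> has
  volume proportional to \<open>c\<close>. In this variable no Jacobian appears.
\<close>
lemma nn_integral_radial:
  fixes f :: "real \<Rightarrow> ennreal"
  assumes [measurable]: "f \<in> borel_measurable borel"
  shows "(\<integral>\<^sup>+ x. f (norm (x::'a::euclidean_space) ^ DIM('a)) \<partial>lborel) =
           ennreal (unit_ball_vol DIM('a)) * (\<integral>\<^sup>+ t. f t * indicator {0..} t \<partial>lborel)"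
proof -
  let ?n = "DIM('a)" and ?V = "ennreal (unit_ball_vol DIM('a))"
  let ?D = "distr lborel borel (\<lambda>x::'a. norm x ^ ?n)"
  let ?R = "density lborel (\<lambda>t::real. ?V * indicator {0..} t)"
  have D: "emeasure ?D {..c} = ennreal (unit_ball_vol ?n * max 0 c)" for c :: real
  proof -
    have "(\<lambda>x::'a. norm x ^ ?n) -` {..c} = (if c < 0 then {} else cball 0 (root ?n c))"
    proof -
      have "norm x ^ ?n \<le> c \<longleftrightarrow> norm x \<le> root ?n c" if "0 \<le> c" for x :: 'a
        using that by (metis DIM_positive norm_ge_zero real_root_le_iff real_root_power_cancel)
      then show ?thesis
        by (auto simp: not_less) (metis norm_ge_zero not_less order_trans zero_le_power)
    qed
    then have "emeasure ?D {..c} = emeasure lborel (if c < 0 then {} else cball (0::'a) (root ?n c))"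
      by (simp add: emeasure_distr)
    also have "\<dots> = ennreal (unit_ball_vol ?n * max 0 c)"
      by (auto simp: emeasure_cball max_def)
    finally show ?thesis .
  qed
  have R: "emeasure ?R {..c} = ennreal (unit_ball_vol ?n * max 0 c)" for c :: real
  proof -
    have "emeasure ?R {..c} = (\<integral>\<^sup>+ t. ?V * indicator {0..c} t \<partial>lborel)"
      by (subst emeasure_density) (auto intro!: nn_integral_cong simp: indicator_def)
    also have "\<dots> = ennreal (unit_ball_vol ?n * max 0 c)"
      by (auto simp: nn_integral_cmult ennreal_mult max_def)
    finally show ?thesis .
  qed
  have "?D = ?R"
  proof (rule measure_eqI_generator_eq_countable)
    let ?E = "range (\<lambda>c::real. {..c})"
    show "Int_stable ?E"
      by (auto simp: Int_stable_def)
    show "sets ?D = sigma_sets UNIV ?E" "sets ?R = sigma_sets UNIV ?E"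
      by (simp_all add: borel_eq_atMost)
    show "range (\<lambda>n::nat. {..real n}) \<subseteq> ?E" "countable (range (\<lambda>n::nat. {..real n}))"
      by auto
    show "\<Union> (range (\<lambda>n::nat. {..real n})) = UNIV"
      by (auto intro: real_arch_simple)
  qed (auto simp: D R)
  then have "(\<integral>\<^sup>+ t. f t \<partial>?D) = (\<integral>\<^sup>+ t. f t \<partial>?R)"
    by simp
  then show ?thesis
    by (simp add: nn_integral_distr nn_integral_density mult.assoc mult.left_commute[of "f _"]
        mult.commute[of _ "f _"] flip: nn_integral_cmult)
qed

lemma lborel_distr_orthogonal:
  fixes T :: "real^3 \<Rightarrow> real^3"
  assumes T: "orthogonal_transformation T"
  shows "distr lborel borel T = lborel"
proof (rule lborel_eqI[symmetric])
  fix l u :: "real^3"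
  assume lu: "\<And>b. b \<in> Basis \<Longrightarrow> l \<bullet> b \<le> u \<bullet> b"
  obtain S where S: "orthogonal_transformation S" "\<And>x. S (T x) = x" "\<And>x. T (S x) = x"
    using T orthogonal_transformation_inv orthogonal_transformation_surj[of T]
      orthogonal_transformation_inj by (metis inv_f_f surj_f_inv_f)
  have cont: "continuous_on UNIV T"
    using T by (intro linear_continuous_on)
      (simp add: linear_conv_bounded_linear[symmetric] orthogonal_transformation_linear)
  have TS: "T -` box l u = S ` box l u"
    using S by (auto simp: image_iff) metis
  have open_S: "open (S ` box l u)"
    using open_vimage[OF open_box cont, of l u] by (simp add: TS)
  have lm: "box l u \<in> lmeasurable"
    by simp
  have "emeasure (distr lborel borel T) (box l u) = emeasure lborel (S ` box l u)"
    using borel_measurable_continuous_onI[OF cont] by (simp add: emeasure_distr TS)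
  also have "\<dots> = emeasure lebesgue (S ` box l u)"
    using open_S by (simp add: emeasure_completion main_part sets_completionI_sets)
  also have "\<dots> = emeasure lebesgue (box l u)"
    by (simp only: emeasure_eq_measure2[OF lm] measure_orthogonal_image[OF S(1) lm]
        emeasure_eq_measure2[OF measurable_orthogonal_image[OF S(1) lm]])
  also have "\<dots> = (\<Prod>b\<in>Basis. (u - l) \<bullet> b)"
    using lu by (simp add: emeasure_completion main_part sets_completionI_sets)
  finally show "emeasure (distr lborel borel T) (box l u) = (\<Prod>b\<in>Basis. (u - l) \<bullet> b)" .
qed simp

lemma vector3_measurable:
  "(\<lambda>(a, b, c). vector [a, b, c] :: real^3) \<in> borel_measurable borel" (is "?F \<in> _")
proof -
  have "?F = (\<lambda>p. \<chi> i. if i = 1 then fst p else if i = 2 then fst (snd p) else snd (snd p))"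
    by (auto simp: fun_eq_iff vec_eq_iff forall_3)
  moreover have "continuous_on UNIV \<dots>"
  proof (intro continuous_on_vec_lambda)
    show "continuous_on UNIV (\<lambda>p::real \<times> real \<times> real.
            if i = 1 then fst p else if i = 2 then fst (snd p) else snd (snd p))" for i :: 3
      by (cases "i = 1"; cases "i = 2") (auto intro!: continuous_intros)
  qed
  ultimately show ?thesis
    by (simp add: borel_measurable_continuous_onI)
qed

text \<open>
  This passes from \<open>real^3\<close> to nested pairs, where Fubini's theorem applies.
\<close>
lemma lborel_distr_vector3:
  "distr lborel borel (\<lambda>(a, b, c). vector [a, b, c]) = (lborel :: (real^3) measure)"
proof (rule lborel_eqI[symmetric])
  fix l u :: "real^3"
  assume "\<And>b. b \<in> Basis \<Longrightarrow> l \<bullet> b \<le> u \<bullet> b"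
  then have lu: "l $ i \<le> u $ i" for i
    by (metis axis_in_Basis_iff cart_eq_inner_axis insertI1 Basis_real_def)
  let ?F = "\<lambda>(a, b, c). vector [a, b, c] :: real^3"
  let ?p = "\<lambda>x::real^3. (x $ 1, x $ 2, x $ 3)"
  have meas: "?F \<in> borel_measurable borel"
    by (rule vector3_measurable)
  have "?F -` box l u = box (?p l) (?p u)"
    by (auto simp: mem_box_cart forall_3 mem_box Basis_prod_def)
  then have "emeasure (distr lborel borel ?F) (box l u) = emeasure lborel (box (?p l) (?p u))"
    using meas by (simp add: emeasure_distr)
  also have "\<dots> = ennreal ((u $ 1 - l $ 1) * ((u $ 2 - l $ 2) * (u $ 3 - l $ 3)))"
    using lu by (subst emeasure_lborel_box) (auto simp: Basis_prod_def)
  also have "\<dots> = (\<Prod>b\<in>Basis. (u - l) \<bullet> b)"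
  proof -
    have *: "(Basis :: (real^3) set) = range (\<lambda>i. axis i 1)"
      by (auto simp: Basis_vec_def)
    have "inj (\<lambda>i::3. axis i (1::real))"
      by (auto simp: inj_on_def axis_eq_axis)
    then have "(\<Prod>b\<in>Basis. (u - l) \<bullet> b) = (\<Prod>i\<in>UNIV. (u - l) $ i)"
      unfolding * by (subst prod.reindex) (simp_all add: inner_axis)
    then show ?thesis
      by (simp only: UNIV_3) simp
  qed
  finally show "emeasure (distr lborel borel ?F) (box l u) = (\<Prod>b\<in>Basis. (u - l) \<bullet> b)" .
qed simp

text \<open>
  A rotation takes \<open>e\<close> to the first coordinate axis; the radial formula in the plane of the two
  other coordinates, with the squared distance to the axis as its variable, does the rest.
\<close>
lemma nn_integral_cylindrical:
  fixes e :: "real^3" and f :: "real \<Rightarrow> real \<Rightarrow> ennreal"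
  assumes e: "norm e = 1" and f[measurable]: "case_prod f \<in> borel_measurable borel"
  shows "(\<integral>\<^sup>+ x. f (x \<bullet> e) ((norm x)\<^sup>2 - (x \<bullet> e)\<^sup>2) \<partial>lborel) =
           ennreal pi * (\<integral>\<^sup>+ u. \<integral>\<^sup>+ t. f u t * indicator {0..} t \<partial>lborel \<partial>lborel)"
proof -
  obtain T :: "real^3 \<Rightarrow> real^3" where T: "orthogonal_transformation T" and Te: "T e = axis 1 1"
    by (rule rotation_exists_1[of e "axis 1 1"]) (use e in auto)
  have T_meas[measurable]: "T \<in> borel_measurable borel"
    using T by (intro borel_measurable_continuous_onI linear_continuous_on)
      (simp add: linear_conv_bounded_linear[symmetric] orthogonal_transformation_linear)
  let ?V = "\<lambda>(a, b, c). vector [a, b, c] :: real^3"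
  let ?g = "\<lambda>x::real^3. f (x $ 1) ((norm x)\<^sup>2 - (x $ 1)\<^sup>2)"
  have f': "(\<lambda>x. f (g x) (h x)) \<in> borel_measurable M"
    if "g \<in> borel_measurable M" "h \<in> borel_measurable M" for g h and M :: "'b measure"
    using measurable_compose[OF borel_measurable_Pair[OF that] f] by simp
  have g[measurable]: "?g \<in> borel_measurable borel"
    by (rule f'; intro borel_measurable_continuous_onI continuous_intros)
  have "(\<integral>\<^sup>+ x. f (x \<bullet> e) ((norm x)\<^sup>2 - (x \<bullet> e)\<^sup>2) \<partial>lborel) = (\<integral>\<^sup>+ x. ?g (T x) \<partial>lborel)"
  proof (intro nn_integral_cong)
    fix x :: "real^3"
    have "x \<bullet> e = T x \<bullet> T e"
      using T by (simp add: orthogonal_transformation_def)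
    then have "x \<bullet> e = T x $ 1" "norm (T x) = norm x"
      using orthogonal_transformation_norm[OF T] by (simp_all add: Te inner_axis)
    then show "f (x \<bullet> e) ((norm x)\<^sup>2 - (x \<bullet> e)\<^sup>2) = ?g (T x)"
      by simp
  qed
  also have "\<dots> = (\<integral>\<^sup>+ x. ?g x \<partial>distr lborel borel T)"
    by (simp add: nn_integral_distr)
  also have "\<dots> = (\<integral>\<^sup>+ x. ?g x \<partial>distr lborel borel ?V)"
    by (simp only: lborel_distr_orthogonal[OF T] lborel_distr_vector3)
  also have "\<dots> = (\<integral>\<^sup>+ x. ?g (?V x) \<partial>lborel)"
    by (intro nn_integral_distr) (use vector3_measurable in \<open>simp_all\<close>)
  also have "\<dots> = (\<integral>\<^sup>+ (u, y::real \<times> real). f u ((norm y)\<^sup>2) \<partial>(lborel \<Otimes>\<^sub>M lborel))"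
    unfolding lborel_prod
    by (intro nn_integral_cong)
      (auto simp: norm_vec_def L2_set_def sum_3 norm_Pair real_sqrt_pow2)
  also have "\<dots> = (\<integral>\<^sup>+ u. \<integral>\<^sup>+ y. f u ((norm (y::real \<times> real))\<^sup>2) \<partial>lborel \<partial>lborel)"
    unfolding case_prod_beta
    by (subst lborel.nn_integral_fst[symmetric]) (auto intro!: f')
  also have "\<dots> = (\<integral>\<^sup>+ u. ennreal pi * (\<integral>\<^sup>+ t. f u t * indicator {0..} t \<partial>lborel) \<partial>lborel)"
  proof (intro nn_integral_cong)
    fix u :: real
    show "(\<integral>\<^sup>+ y. f u ((norm (y::real \<times> real))\<^sup>2) \<partial>lborel) =
            ennreal pi * (\<integral>\<^sup>+ t. f u t * indicator {0..} t \<partial>lborel)"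
    proof -
      have "(\<lambda>t. f u t) \<in> borel_measurable borel"
        by (rule f') simp_all
      from nn_integral_radial[OF this, where 'a = "real \<times> real"] show ?thesis
        by (simp add: unit_ball_vol_2 power2_eq_square)
    qed
  qed
  also have "\<dots> = ennreal pi * (\<integral>\<^sup>+ u. \<integral>\<^sup>+ t. f u t * indicator {0..} t \<partial>lborel \<partial>lborel)"
    by (intro nn_integral_cmult lborel.borel_measurable_nn_integral)
      (auto intro!: f' borel_measurable_times_ennreal simp: case_prod_unfold)
  finally show ?thesis .
qed


section \<open>Averages over the sphere\<close>

lemma nn_integral_powr_tail:
  fixes a c x :: real
  assumes a: "a > 1" and c: "c > 0" and x: "x > 0"
  shows "(\<integral>\<^sup>+ t. ennreal ((x + c * t) powr - a) * indicator {0..} t \<partial>lborel) =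
           ennreal (x powr (1 - a) / (c * (a - 1)))"
proof -
  define F where "F = (\<lambda>t. - ((x + c * t) powr (1 - a)) / (c * (a - 1)))"
  have "(\<integral>\<^sup>+ t. ennreal ((x + c * t) powr - a) * indicator {0..} t \<partial>lborel) = ennreal (0 - F 0)"
  proof (rule nn_integral_FTC_atLeast)
    show "DERIV F t :> (x + c * t) powr - a" if "0 \<le> t" for t
    proof -
      have "0 < x + c * t"
        using that c x by (simp add: add_pos_nonneg)
      then have "DERIV F t :> - ((1 - a) * (x + c * t) powr (1 - a - 1) * c) / (c * (a - 1))"
        unfolding F_def using a c by (auto intro!: derivative_eq_intros)
      moreover have "- ((1 - a) * (x + c * t) powr (1 - a - 1) * c) / (c * (a - 1)) = (x + c * t) powr - a"
        using a c by (simp add: field_simps)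
      ultimately show ?thesis
        by simp
    qed
    have "filterlim (\<lambda>t. x + c * t) at_top at_top"
      by (intro filterlim_tendsto_add_at_top[OF tendsto_const]
          filterlim_tendsto_pos_mult_at_top[OF tendsto_const c] filterlim_ident)
    then have "((\<lambda>t. (x + c * t) powr (1 - a)) \<longlongrightarrow> 0) at_top"
      using a by (intro tendsto_neg_powr) auto
    then have "((\<lambda>t. - ((x + c * t) powr (1 - a)) / (c * (a - 1))) \<longlongrightarrow> - 0 / (c * (a - 1))) at_top"
      using a c by (intro tendsto_intros) auto
    then show "(F \<longlongrightarrow> 0) at_top"
      by (simp add: F_def)
  qed auto
  then show ?thesis
    by (simp add: F_def)
qed

lemma nn_integral_sphere_measure:
  fixes f :: "'a::euclidean_space \<Rightarrow> ennreal"
  assumes [measurable]: "f \<in> borel_measurable borel"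
  shows "(\<integral>\<^sup>+ \<sigma>. f \<sigma> \<partial>sphere_measure) =
           of_nat DIM('a) * (\<integral>\<^sup>+ x. f (x /\<^sub>R norm x) * indicator (ball 0 1 - {0}) x \<partial>lborel)"
proof -
  have f: "f \<in> borel_measurable (restrict_space borel (sphere 0 1))"
    by (intro measurable_restrict_space1) simp
  show ?thesis
    unfolding sphere_measure_def
    by (subst nn_integral_scale_measure) (use f in
      \<open>simp_all add: nn_integral_distr[OF measurable_direction] nn_integral_restrict_space\<close>)
qed

lemma sphere_kernel_trivial_bound:
  fixes e :: "real^3"
  assumes "norm e = 1" and X: "X > 0" and Y: "Y \<ge> 0" and p: "p \<ge> 0"
  shows "(\<integral>\<^sup>+ \<sigma>. ennreal ((X + Y * (1 - (\<sigma> \<bullet> e)\<^sup>2)) powr - p) \<partial>sphere_measure) \<le>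
           ennreal (4 * pi * X powr - p)"
proof -
  have "(\<integral>\<^sup>+ \<sigma>. ennreal ((X + Y * (1 - (\<sigma> \<bullet> e)\<^sup>2)) powr - p) \<partial>sphere_measure) \<le>
          (\<integral>\<^sup>+ \<sigma>. ennreal (X powr - p) \<partial>(sphere_measure :: (real^3) measure))"
  proof (intro nn_integral_mono ennreal_leI)
    fix \<sigma> :: "real^3" assume "\<sigma> \<in> space sphere_measure"
    then have "\<bar>\<sigma> \<bullet> e\<bar> \<le> 1"
      using Cauchy_Schwarz_ineq2[of \<sigma> e] assms by simp
    then have "X \<le> X + Y * (1 - (\<sigma> \<bullet> e)\<^sup>2)"
      using Y by (simp add: abs_square_le_1)
    then show "(X + Y * (1 - (\<sigma> \<bullet> e)\<^sup>2)) powr - p \<le> X powr - p"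
      using X p by (intro powr_mono2') auto
  qed
  also have "\<dots> = ennreal (4 * pi * X powr - p)"
    by (simp add: emeasure_sphere_measure_total ennreal_mult mult.commute)
  finally show ?thesis .
qed

text \<open>
  The sphere is replaced by the cone over it, the unit ball. For \<open>x\<close> in the ball with direction
  \<open>\<sigma>\<close>, the number \<open>1 - (\<sigma> \<bullet> e)\<^sup>2\<close> is at least the squared distance of \<open>x\<close> to the axis of \<open>e\<close>, so
  the integrand is dominated by a function of this distance. The ball lies in a cylinder of height
  2 about this axis, on which the integral is elementary.
\<close>
lemma sphere_kernel_bound:
  fixes e :: "real^3"
  assumes e: "norm e = 1" and X: "X > 0" and Y: "Y > 0" and p: "p > 1"
  shows "(\<integral>\<^sup>+ \<sigma>. ennreal ((X + Y * (1 - (\<sigma> \<bullet> e)\<^sup>2)) powr - p) \<partial>sphere_measure) \<le>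
           ennreal (6 * pi * X powr (1 - p) / (Y * (p - 1)))"
proof -
  let ?f = "\<lambda>u t. ennreal ((X + Y * t) powr - p) * indicator {-1..1::real} u"
  have "(\<integral>\<^sup>+ \<sigma>. ennreal ((X + Y * (1 - (\<sigma> \<bullet> e)\<^sup>2)) powr - p) \<partial>sphere_measure) =
          3 * (\<integral>\<^sup>+ x. ennreal ((X + Y * (1 - ((x /\<^sub>R norm x) \<bullet> e)\<^sup>2)) powr - p) *
            indicator (ball 0 1 - {0}) x \<partial>lborel)"
    by (subst nn_integral_sphere_measure) simp_all
  also have "\<dots> \<le> 3 * (\<integral>\<^sup>+ x. ?f (x \<bullet> e) ((norm x)\<^sup>2 - (x \<bullet> e)\<^sup>2) \<partial>lborel)"
  proof (intro mult_left_mono nn_integral_mono)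
    fix x :: "real^3"
    show "ennreal ((X + Y * (1 - ((x /\<^sub>R norm x) \<bullet> e)\<^sup>2)) powr - p) * indicator (ball 0 1 - {0}) x
            \<le> ?f (x \<bullet> e) ((norm x)\<^sup>2 - (x \<bullet> e)\<^sup>2)"
    proof (cases "x \<in> ball 0 1 - {0}")
      case True
      then have n: "0 < norm x" "norm x \<le> 1"
        by auto
      have xe: "\<bar>x \<bullet> e\<bar> \<le> norm x"
        using Cauchy_Schwarz_ineq2[of x e] e by simp
      then have t: "0 \<le> (norm x)\<^sup>2 - (x \<bullet> e)\<^sup>2"
        using abs_le_square_iff[of "x \<bullet> e" "norm x"] by simp
      have "(norm x)\<^sup>2 - (x \<bullet> e)\<^sup>2 \<le> ((norm x)\<^sup>2 - (x \<bullet> e)\<^sup>2) / (norm x)\<^sup>2"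
        using n t by (simp add: le_divide_eq power_le_one mult_left_le)
      also have "\<dots> = 1 - ((x /\<^sub>R norm x) \<bullet> e)\<^sup>2"
      proof -
        have "(x /\<^sub>R norm x) \<bullet> e = (x \<bullet> e) / norm x"
          by (simp add: divide_inverse_commute)
        then show ?thesis
          using n by (simp add: diff_divide_distrib power_divide)
      qed
      finally have "X + Y * ((norm x)\<^sup>2 - (x \<bullet> e)\<^sup>2) \<le> X + Y * (1 - ((x /\<^sub>R norm x) \<bullet> e)\<^sup>2)"
        using Y by simp
      then have "(X + Y * (1 - ((x /\<^sub>R norm x) \<bullet> e)\<^sup>2)) powr - p
          \<le> (X + Y * ((norm x)\<^sup>2 - (x \<bullet> e)\<^sup>2)) powr - p"
        using X Y p t by (intro powr_mono2') (auto intro: add_pos_nonneg)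
      moreover have "x \<bullet> e \<in> {-1..1}"
        using xe n by auto
      ultimately show ?thesis
        using True by (simp add: ennreal_leI)
    qed simp
  qed simp
  also have "\<dots> = 3 * (ennreal pi * (\<integral>\<^sup>+ u. \<integral>\<^sup>+ t. ?f u t * indicator {0..} t \<partial>lborel \<partial>lborel))"
    by (subst nn_integral_cylindrical[OF e]) (simp_all add: borel_prod[symmetric])
  also have "(\<integral>\<^sup>+ u. \<integral>\<^sup>+ t. ?f u t * indicator {0..} t \<partial>lborel \<partial>lborel) =
      (\<integral>\<^sup>+ u. ennreal (X powr (1 - p) / (Y * (p - 1))) * indicator {-1..1::real} u \<partial>lborel)"
  proof (intro nn_integral_cong)
    fix u :: real
    have "(\<integral>\<^sup>+ t. ?f u t * indicator {0..} t \<partial>lborel) =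
        (\<integral>\<^sup>+ t. (ennreal ((X + Y * t) powr - p) * indicator {0..} t) * indicator {-1..1} u \<partial>lborel)"
      by (intro nn_integral_cong) (simp only: mult_ac)
    also have "\<dots> = (\<integral>\<^sup>+ t. ennreal ((X + Y * t) powr - p) * indicator {0..} t \<partial>lborel) * indicator {-1..1} u"
      by (intro nn_integral_multc) simp
    finally show "(\<integral>\<^sup>+ t. ?f u t * indicator {0..} t \<partial>lborel) =
        ennreal (X powr (1 - p) / (Y * (p - 1))) * indicator {-1..1} u"
      by (simp only: nn_integral_powr_tail[OF p Y X])
  qed
  also have "\<dots> = ennreal (X powr (1 - p) / (Y * (p - 1))) * 2"
    by (simp add: nn_integral_cmult)
  also have "3 * (ennreal pi * (ennreal (X powr (1 - p) / (Y * (p - 1))) * 2)) =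
      ennreal (6 * pi * X powr (1 - p) / (Y * (p - 1)))"
  proof -
    define z where "z = X powr (1 - p) / (Y * (p - 1))"
    have "z \<ge> 0"
      using Y p by (simp add: z_def)
    then have "3 * (ennreal pi * (ennreal z * 2)) = ennreal (3 * (pi * (z * 2)))"
      by (simp add: ennreal_mult[symmetric] flip: ennreal_numeral)
    then show ?thesis
      by (simp add: z_def mult_ac)
  qed
  finally show ?thesis .
qed

text \<open>
  If \<open>Z > 2 * X\<close>, then \<open>Z - X\<close> and \<open>Z\<close> are comparable and \<open>sphere_kernel_bound\<close> applies;
  otherwise \<open>X\<close> and \<open>Z\<close> are comparable and the supremum of the integrand is good enough. The
  combined bound stays finite where \<open>Z = X\<close>, which in the collision integral happens for \<open>v = w\<close>
  and \<open>v = - w\<close>, and so introduces no new singularity there.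
\<close>
lemma sphere_kernel_bound_max:
  fixes e :: "real^3"
  assumes e: "norm e = 1" and X: "0 < X" and Z: "X \<le> Z" and p: "p > 1"
  shows "(\<integral>\<^sup>+ \<sigma>. ennreal ((X + (Z - X) * (1 - (\<sigma> \<bullet> e)\<^sup>2)) powr - p) \<partial>sphere_measure) \<le>
           ennreal (12 * pi * (1 + 1 / (p - 1)) * (X powr (1 - p) / Z))"
proof (cases "Z \<le> 2 * X")
  case True
  have "4 * pi * X powr - p = 4 * pi * (X powr (1 - p) / X)"
    using X by (simp add: powr_diff powr_minus field_simps)
  also have "\<dots> \<le> 4 * pi * (X powr (1 - p) / (Z / 2))"
    using X Z True by (intro mult_left_mono divide_left_mono) auto
  also have "\<dots> = 8 * pi * (X powr (1 - p) / Z)"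
    by simp
  also have "\<dots> \<le> 12 * pi * 1 * (X powr (1 - p) / Z)"
    using X Z by (intro mult_right_mono) auto
  also have "\<dots> \<le> 12 * pi * (1 + 1 / (p - 1)) * (X powr (1 - p) / Z)"
    using X Z p by (intro mult_right_mono mult_left_mono) auto
  finally show ?thesis
    using sphere_kernel_trivial_bound[OF e X, of "Z - X" p] Z p
    by (auto intro: order_trans ennreal_leI)
next
  case False
  have "6 * pi * X powr (1 - p) / ((Z - X) * (p - 1)) = (6 * pi / (p - 1)) * (X powr (1 - p) / (Z - X))"
    by simp
  also have "\<dots> \<le> (6 * pi / (p - 1)) * (X powr (1 - p) / (Z / 2))"
    using X False p by (intro mult_left_mono divide_left_mono) auto
  also have "\<dots> = 12 * pi * (1 / (p - 1)) * (X powr (1 - p) / Z)"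
    by simp
  also have "\<dots> \<le> 12 * pi * (1 + 1 / (p - 1)) * (X powr (1 - p) / Z)"
    using X Z p by (intro mult_right_mono mult_left_mono) auto
  finally show ?thesis
    using sphere_kernel_bound[OF e X, of "Z - X" p] False X p
    by (auto intro: order_trans ennreal_leI)
qed

text \<open>
  The same alternative, but with a factor \<open>1 / p\<close> and a fixed exponent \<open>p\<^sub>0\<close> on the right. In the
  comparable case \<open>X \<ge> 2\<close>, because \<open>Z \<ge> 4\<close>; there \<open>X powr - (p - p\<^sub>0)\<close> is exponentially small in
  \<open>p - p\<^sub>0\<close>, which more than pays for \<open>1 / p\<close>.
\<close>
lemma sphere_kernel_bound_uniform:
  fixes e :: "real^3"
  assumes e: "norm e = 1" and X: "1 \<le> X" and Z: "X \<le> Z" "4 \<le> Z" and p: "1 < p\<^sub>0" "p\<^sub>0 \<le> p"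
  shows "(\<integral>\<^sup>+ \<sigma>. ennreal ((X + (Z - X) * (1 - (\<sigma> \<bullet> e)\<^sup>2)) powr - p) \<partial>sphere_measure) \<le>
           ennreal (16 * pi * p\<^sub>0 * (1 + 1 / (p\<^sub>0 - 1)) / p * (X powr (1 - p\<^sub>0) / Z))"
proof (cases "Z \<le> 2 * X")
  case True
  then have X2: "2 \<le> X"
    using Z by simp
  have "X powr - p = X powr - p\<^sub>0 * X powr - (p - p\<^sub>0)"
    by (simp flip: powr_add)
  also have "X powr - (p - p\<^sub>0) \<le> 2 powr - (p - p\<^sub>0)"
    using X2 p by (intro powr_mono2') auto
  also have "2 powr - (p - p\<^sub>0) \<le> 2 * p\<^sub>0 / p"
  proof -
    have "p \<le> p\<^sub>0 * (1 + (p - p\<^sub>0))"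
    proof -
      have "0 \<le> (p\<^sub>0 - 1) * (p - p\<^sub>0)"
        using p by simp
      then show ?thesis
        by (simp add: algebra_simps)
    qed
    also have "1 + (p - p\<^sub>0) \<le> 2 * 2 powr (p - p\<^sub>0)"
    proof -
      have "1 + d \<le> 2 * 2 powr d" if "0 \<le> d" for d :: real
      proof -
        have "1 + d * ln 2 \<le> 2 powr d"
          using exp_ge_add_one_self[of "d * ln 2"] by (simp add: powr_def)
        moreover have "d * (1 / 2) \<le> d * ln 2"
          using that ln2_ge_two_thirds by (intro mult_left_mono) auto
        ultimately show ?thesis
          using that by linarith
      qed
      then show ?thesis
        using p by simp
    qed
    finally have "p \<le> p\<^sub>0 * (2 * 2 powr (p - p\<^sub>0))"
      using p by simp
    then show ?thesis
      using p by (simp add: powr_minus field_simps powr_diff)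
  qed
  finally have "X powr - p \<le> X powr - p\<^sub>0 * (2 * p\<^sub>0 / p)"
    using X by simp
  moreover have "X powr (1 - p\<^sub>0) / X = X powr - p\<^sub>0"
    using X by (simp add: powr_diff powr_minus_divide)
  ultimately have "4 * pi * X powr - p \<le> 4 * pi * (2 * p\<^sub>0 / p * (X powr (1 - p\<^sub>0) / X))"
    by (intro mult_left_mono) (simp_all add: mult.commute)
  also have "\<dots> \<le> 4 * pi * (2 * p\<^sub>0 / p * (X powr (1 - p\<^sub>0) / (Z / 2)))"
    using X Z True p by (intro mult_left_mono divide_left_mono) auto
  also have "\<dots> = 16 * pi * p\<^sub>0 * 1 / p * (X powr (1 - p\<^sub>0) / Z)"
    by simp
  also have "\<dots> \<le> 16 * pi * p\<^sub>0 * (1 + 1 / (p\<^sub>0 - 1)) / p * (X powr (1 - p\<^sub>0) / Z)"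
    using X Z p by (intro mult_right_mono mult_left_mono divide_right_mono) auto
  finally show ?thesis
    using sphere_kernel_trivial_bound[OF e, of X "Z - X" p] X Z p
    by (auto intro: order_trans ennreal_leI)
next
  case False
  have "6 * pi * X powr (1 - p) / ((Z - X) * (p - 1)) = 6 * pi * (1 / (p - 1)) * (X powr (1 - p) / (Z - X))"
    by simp
  also have "\<dots> \<le> 6 * pi * (p\<^sub>0 / (p\<^sub>0 - 1) / p) * (X powr (1 - p\<^sub>0) / (Z / 2))"
  proof -
    have "1 / (p - 1) \<le> p\<^sub>0 / (p\<^sub>0 - 1) / p"
      using p by (simp add: field_simps)
    moreover have "X powr (1 - p) / (Z - X) \<le> X powr (1 - p\<^sub>0) / (Z / 2)"
      using X Z False p by (intro frac_le powr_mono) auto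
    ultimately show ?thesis
      using X Z p by (intro mult_mono) auto
  qed
  also have "\<dots> = 12 * pi * (p\<^sub>0 / (p\<^sub>0 - 1) / p) * (X powr (1 - p\<^sub>0) / Z)"
    by simp
  also have "\<dots> \<le> 16 * pi * (p\<^sub>0 / (p\<^sub>0 - 1) / p) * (X powr (1 - p\<^sub>0) / Z)"
    using X Z p by (intro mult_right_mono) auto
  also have "16 * pi * (p\<^sub>0 / (p\<^sub>0 - 1) / p) = 16 * pi * p\<^sub>0 * (1 / (p\<^sub>0 - 1)) / p"
    by simp
  also have "\<dots> * (X powr (1 - p\<^sub>0) / Z) \<le> 16 * pi * p\<^sub>0 * (1 + 1 / (p\<^sub>0 - 1)) / p * (X powr (1 - p\<^sub>0) / Z)"
    using X Z p by (intro mult_right_mono mult_left_mono divide_right_mono) auto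
  finally show ?thesis
    using sphere_kernel_bound[OF e, of X "Z - X" p] False X p
    by (auto intro: order_trans ennreal_leI)
qed


section \<open>Weights after the collision\<close>

lemma jbracket_sq: "\<langle>v\<rangle>\<^sup>2 = 1 + (norm v)\<^sup>2"
  by (simp add: jbracket_def powr_half_sqrt)

lemma jbracket_ge_1: "1 \<le> \<langle>v\<rangle>"
  by (simp add: jbracket_def powr_half_sqrt)

lemma jbracket_ge_norm: "norm v \<le> \<langle>v\<rangle>"
  by (simp add: jbracket_def powr_half_sqrt real_le_rsqrt)

lemma jbracket_pos: "0 < \<langle>v\<rangle>"
  using jbracket_ge_1[of v] by linarith

text \<open>
  The minimum and the maximum over \<open>\<sigma>\<close> of the squared product of the post-collisional brackets,
  relative to \<open>\<langle>v\<rangle>\<^sup>2\<close>. They are attained when \<open>\<sigma>\<close> is parallel, respectively orthogonal, to \<open>v + w\<close>.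
\<close>
definition post_min :: "real^3 \<Rightarrow> real^3 \<Rightarrow> real" where
  "post_min v w = (1 + (norm v)\<^sup>2 + (norm w)\<^sup>2 + (v \<bullet> w)\<^sup>2) / \<langle>v\<rangle>\<^sup>2"

definition post_max :: "real^3 \<Rightarrow> real^3 \<Rightarrow> real" where
  "post_max v w = (1 + ((norm v)\<^sup>2 + (norm w)\<^sup>2) / 2)\<^sup>2 / \<langle>v\<rangle>\<^sup>2"

lemma post_max_minus_min:
  "post_max v w - post_min v w = (norm (v - w))\<^sup>2 * (norm (v + w))\<^sup>2 / (4 * \<langle>v\<rangle>\<^sup>2)"
proof -
  have "(norm (v - w))\<^sup>2 = (norm v)\<^sup>2 + (norm w)\<^sup>2 - 2 * (v \<bullet> w)"
    "(norm (v + w))\<^sup>2 = (norm v)\<^sup>2 + (norm w)\<^sup>2 + 2 * (v \<bullet> w)"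
    by (simp_all add: power2_norm_eq_inner inner_diff_left inner_diff_right inner_add_left
        inner_add_right inner_commute[of w v])
  then have "(norm (v - w))\<^sup>2 * (norm (v + w))\<^sup>2 / 4 =
      (1 + ((norm v)\<^sup>2 + (norm w)\<^sup>2) / 2)\<^sup>2 - (1 + (norm v)\<^sup>2 + (norm w)\<^sup>2 + (v \<bullet> w)\<^sup>2)"
    by (simp only:) (simp add: power2_eq_square field_simps)
  then have "post_max v w - post_min v w = (norm (v - w))\<^sup>2 * (norm (v + w))\<^sup>2 / 4 / \<langle>v\<rangle>\<^sup>2"
    unfolding post_max_def post_min_def diff_divide_distrib[symmetric] by (simp only:)
  then show ?thesis
    by simp
qed

lemma post_min_le_max: "post_min v w \<le> post_max v w"
proof -
  have "0 \<le> post_max v w - post_min v w"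
    unfolding post_max_minus_min by simp
  then show ?thesis
    by simp
qed

text \<open>
  By conservation of momentum and energy, \<open>\<sigma>\<close> enters the two post-collisional energies only
  through \<open>\<plusminus> norm (v - w) * ((v + w) \<bullet> \<sigma>) / 2\<close>, which cancels to first order in their product.
  Writing \<open>v + w\<close> as a multiple of a unit vector \<open>e\<close> keeps the case \<open>v + w = 0\<close> uniform.
\<close>
lemma post_product:
  assumes \<sigma>: "norm \<sigma> = 1" and e: "v + w = norm (v + w) *\<^sub>R e"
  shows "\<langle>post_v v w \<sigma>\<rangle>\<^sup>2 * \<langle>post_w v w \<sigma>\<rangle>\<^sup>2 / \<langle>v\<rangle>\<^sup>2 =
           post_min v w + (post_max v w - post_min v w) * (1 - (\<sigma> \<bullet> e)\<^sup>2)"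
proof -
  define r s c where "r = norm (v - w)" and "s = norm (v + w)" and "c = \<sigma> \<bullet> e"
  have ip: "(v + w) \<bullet> \<sigma> = s * c"
    by (subst e) (simp add: s_def c_def inner_commute[of e])
  have rs: "r\<^sup>2 + s\<^sup>2 = 2 * ((norm v)\<^sup>2 + (norm w)\<^sup>2)"
    by (simp add: r_def s_def power2_norm_eq_inner inner_diff_left inner_diff_right inner_add_left
        inner_add_right inner_commute[of w v])
  have sq: "(norm (x + y))\<^sup>2 = (norm x)\<^sup>2 + (norm y)\<^sup>2 + 2 * (x \<bullet> y)" for x y :: "real^3"
    by (simp add: power2_norm_eq_inner inner_add_left inner_add_right inner_commute[of y x])
  \<comment> \<open>Both velocities at once: \<open>t = r\<close> gives \<open>post_v\<close>, \<open>t = - r\<close> gives \<open>post_w\<close>.\<close>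
  have comb: "(norm ((1 / 2) *\<^sub>R (v + w) + (t / 2) *\<^sub>R \<sigma>))\<^sup>2 = (s\<^sup>2 + t\<^sup>2 + 2 * t * s * c) / 4"
    for t :: real
  proof -
    have "(norm ((1 / 2) *\<^sub>R (v + w) + (t / 2) *\<^sub>R \<sigma>))\<^sup>2 =
        (norm ((1 / 2) *\<^sub>R (v + w)))\<^sup>2 + (norm ((t / 2) *\<^sub>R \<sigma>))\<^sup>2
          + 2 * (((1 / 2) *\<^sub>R (v + w)) \<bullet> ((t / 2) *\<^sub>R \<sigma>))"
      by (rule sq)
    also have "\<dots> = (s / 2)\<^sup>2 + (t / 2)\<^sup>2 + 2 * (1 / 2 * (t / 2) * (s * c))"
    proof -
      have "norm ((1 / 2) *\<^sub>R (v + w)) = s / 2" "(norm ((t / 2) *\<^sub>R \<sigma>))\<^sup>2 = (t / 2)\<^sup>2"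
        using \<sigma> by (simp_all add: s_def power_divide del: scaleR_add_right)
      moreover have "((1 / 2) *\<^sub>R (v + w)) \<bullet> ((t / 2) *\<^sub>R \<sigma>) = 1 / 2 * (t / 2) * (s * c)"
        unfolding inner_scaleR_left inner_scaleR_right ip by simp
      ultimately show ?thesis
        by (simp only:)
    qed
    finally show ?thesis
      by (simp add: power_divide field_simps)
  qed
  have "(norm (post_v v w \<sigma>))\<^sup>2 = (s\<^sup>2 + r\<^sup>2 + 2 * r * s * c) / 4"
    using comb[of r] by (simp add: post_v_def r_def)
  moreover have "(norm (post_w v w \<sigma>))\<^sup>2 = (s\<^sup>2 + r\<^sup>2 - 2 * r * s * c) / 4"
    using comb[of "- r"] by (simp add: post_w_def r_def)
  ultimately have "\<langle>post_v v w \<sigma>\<rangle>\<^sup>2 * \<langle>post_w v w \<sigma>\<rangle>\<^sup>2 =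
      (1 + (r\<^sup>2 + s\<^sup>2) / 4)\<^sup>2 - r\<^sup>2 * s\<^sup>2 * c\<^sup>2 / 4"
    by (simp only: jbracket_sq) (simp add: power2_eq_square field_simps)
  then have "\<langle>post_v v w \<sigma>\<rangle>\<^sup>2 * \<langle>post_w v w \<sigma>\<rangle>\<^sup>2 / \<langle>v\<rangle>\<^sup>2 = post_max v w - (post_max v w - post_min v w) * c\<^sup>2"
    unfolding post_max_minus_min unfolding post_max_def r_def[symmetric] s_def[symmetric] rs
    by (simp add: diff_divide_distrib mult_ac)
  then show ?thesis
    by (simp add: c_def algebra_simps)
qed

lemma post_min_ge_1: "1 \<le> post_min v w"
proof -
  have "0 < 1 + (norm v)\<^sup>2"
    by (intro add_pos_nonneg) auto
  then show ?thesis
    by (simp add: post_min_def jbracket_sq le_divide_eq_1_pos)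
qed

lemma weight_quotient:
  assumes \<sigma>: "norm \<sigma> = 1" and e: "v + w = norm (v + w) *\<^sub>R e"
  shows "\<langle>v\<rangle> powr k / (\<langle>post_v v w \<sigma>\<rangle> powr k * \<langle>post_w v w \<sigma>\<rangle> powr k) =
           (post_min v w + (post_max v w - post_min v w) * (1 - (\<sigma> \<bullet> e)\<^sup>2)) powr - (k / 2)"
proof -
  have *: "\<langle>u\<rangle> powr k = (\<langle>u\<rangle>\<^sup>2) powr (k / 2)" for u
    using jbracket_pos[of u] by (simp add: powr_powr flip: powr_numeral)
  show ?thesis
    unfolding post_product[OF assms, symmetric] *
    by (simp add: powr_minus powr_mult powr_divide)
qed

lemma exists_direction: "\<exists>e. norm e = 1 \<and> x = norm x *\<^sub>R e" for x :: "real^3"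
proof (cases "x = 0")
  case True
  then show ?thesis
    by (intro exI[of _ "axis 1 1"]) simp
next
  case False
  then show ?thesis
    by (intro exI[of _ "x /\<^sub>R norm x"]) simp
qed

text \<open>
  Any bound \<open>K * X powr - q / Z\<close> for the spherical average reduces the collision integral to one
  weighted integral over \<open>w\<close>, in which only \<open>q\<close> remembers the exponent \<open>k\<close>.
\<close>
lemma collision_integral_le:
  assumes K: "0 \<le> K"
    and N: "\<And>w (e::real^3). norm e = 1 \<Longrightarrow>
      (\<integral>\<^sup>+ \<sigma>. ennreal ((post_min v w + (post_max v w - post_min v w) * (1 - (\<sigma> \<bullet> e)\<^sup>2)) powr - (k / 2))
         \<partial>sphere_measure) \<le> ennreal (K * (post_min v w powr - q / post_max v w))"
  shows "collision_integral \<gamma> k v \<le>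
     ennreal K * (\<integral>\<^sup>+ w. ennreal (norm (v - w) powr \<gamma> * (post_min v w powr - q / post_max v w)) \<partial>lborel)"
proof -
  let ?G = "\<lambda>w. norm (v - w) powr \<gamma> * (post_min v w powr - q / post_max v w)"
  have "collision_integral \<gamma> k v \<le> (\<integral>\<^sup>+ w. ennreal K * ennreal (?G w) \<partial>lborel)"
    unfolding collision_integral_def
  proof (intro nn_integral_mono)
    fix w :: "real^3"
    obtain e :: "real^3" where e: "norm e = 1" "v + w = norm (v + w) *\<^sub>R e"
      using exists_direction by blast
    have "(\<integral>\<^sup>+ \<sigma>. ennreal (norm (v - w) powr \<gamma> *
             (\<langle>v\<rangle> powr k / (\<langle>post_v v w \<sigma>\<rangle> powr k * \<langle>post_w v w \<sigma>\<rangle> powr k))) \<partial>sphere_measure) =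
          (\<integral>\<^sup>+ \<sigma>. ennreal (norm (v - w) powr \<gamma>) * ennreal ((post_min v w +
             (post_max v w - post_min v w) * (1 - (\<sigma> \<bullet> e)\<^sup>2)) powr - (k / 2)) \<partial>sphere_measure)"
      by (intro nn_integral_cong) (simp add: weight_quotient[OF _ e(2)] ennreal_mult)
    also have "\<dots> = ennreal (norm (v - w) powr \<gamma>) * (\<integral>\<^sup>+ \<sigma>. ennreal ((post_min v w +
             (post_max v w - post_min v w) * (1 - (\<sigma> \<bullet> e)\<^sup>2)) powr - (k / 2)) \<partial>sphere_measure)"
      by (intro nn_integral_cmult)
        (simp add: measurable_cong_sets[OF sets_sphere_measure refl] measurable_restrict_space1)
    also have "\<dots> \<le> ennreal (norm (v - w) powr \<gamma>) * ennreal (K * (post_min v w powr - q / post_max v w))"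
      by (rule mult_left_mono[OF N[OF e(1)]]) simp
    also have "\<dots> = ennreal K * ennreal (?G w)"
    proof -
      have "0 \<le> post_max v w"
        using post_min_ge_1[of v w] post_min_le_max[of v w] by linarith
      then show ?thesis
        using K by (simp add: ennreal_mult[symmetric] mult_ac)
    qed
    finally show "(\<integral>\<^sup>+ \<sigma>. ennreal (norm (v - w) powr \<gamma> *
             (\<langle>v\<rangle> powr k / (\<langle>post_v v w \<sigma>\<rangle> powr k * \<langle>post_w v w \<sigma>\<rangle> powr k))) \<partial>sphere_measure)
             \<le> ennreal K * ennreal (?G w)" .
  qed
  also have "\<dots> = ennreal K * (\<integral>\<^sup>+ w. ennreal (?G w) \<partial>lborel)"
    by (intro nn_integral_cmult) (simp add: post_min_def post_max_def)
  finally show ?thesis .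
qed


section \<open>Integration over the second velocity\<close>

lemma nn_integral_japanese_line:
  fixes a :: real
  assumes a: "a > 1 / 2"
  shows "(\<integral>\<^sup>+ u. ennreal ((1 + u\<^sup>2) powr - a) \<partial>lborel) \<le> ennreal (2 * (2 powr a / (2 * a - 1)))"
proof -
  have "(\<integral>\<^sup>+ u. ennreal ((1 + u\<^sup>2) powr - a) \<partial>lborel) =
      2 * (\<integral>\<^sup>+ t. ennreal ((1 + t\<^sup>2) powr - a) * indicator {0..} t \<partial>lborel)"
    using nn_integral_radial[of "\<lambda>t. ennreal ((1 + t\<^sup>2) powr - a)", where 'a = real] by simp
  also have "(\<integral>\<^sup>+ t. ennreal ((1 + t\<^sup>2) powr - a) * indicator {0..} t \<partial>lborel) \<le>
      (\<integral>\<^sup>+ t. ennreal (2 powr a) * (ennreal ((1 + 1 * t) powr - (2 * a)) * indicator {0..} t) \<partial>lborel)"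
  proof (intro nn_integral_mono)
    fix t :: real
    show "ennreal ((1 + t\<^sup>2) powr - a) * indicator {0..} t \<le>
            ennreal (2 powr a) * (ennreal ((1 + 1 * t) powr - (2 * a)) * indicator {0..} t)"
    proof (cases "t \<ge> 0")
      case True
      have "(1 + t)\<^sup>2 / 2 \<le> 1 + t\<^sup>2"
        using sum_squares_ge_zero[of "1 - t" 0] by (simp add: power2_eq_square algebra_simps)
      then have "(1 + t\<^sup>2) powr - a \<le> ((1 + t)\<^sup>2 / 2) powr - a"
        using a True by (intro powr_mono2') auto
      also have "\<dots> = 2 powr a * (1 + t) powr - (2 * a)"
        using True by (simp add: powr_divide powr_powr powr_minus_divide flip: powr_numeral)
      finally show ?thesis
        using True by (simp add: ennreal_leI flip: ennreal_mult)
    qed simp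
  qed
  also have "\<dots> = ennreal (2 powr a) * ennreal (1 / (2 * a - 1))"
    using a nn_integral_powr_tail[of "2 * a" 1 1] by (subst nn_integral_cmult) simp_all
  also have "2 * (ennreal (2 powr a) * ennreal (1 / (2 * a - 1))) = ennreal (2 * (2 powr a / (2 * a - 1)))"
    using a by (simp add: ennreal_mult[symmetric] flip: ennreal_numeral)
  finally show ?thesis
    by (simp add: mult_left_mono)
qed

text \<open>
  In the variable \<open>s = norm (v - w) ^ 3\<close> the integrand is \<open>s powr (\<gamma> / 3)\<close>, integrable at \<open>0\<close>
  exactly when \<open>\<gamma> > -3\<close>.
\<close>
lemma nn_integral_norm_powr_ball:
  fixes v :: "real^3"
  assumes g: "-3 < \<gamma>" and R: "0 < R"
  shows "(\<integral>\<^sup>+ w. ennreal (norm (v - w) powr \<gamma>) * indicator {w. norm (v - w) \<le> R} w \<partial>lborel) =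
           ennreal (4 * pi / (3 + \<gamma>) * R powr (3 + \<gamma>))"
proof -
  let ?f = "\<lambda>s::real. ennreal (s powr (\<gamma> / 3)) * indicator {..R ^ 3} s"
  have "(\<integral>\<^sup>+ w. ennreal (norm (v - w) powr \<gamma>) * indicator {w. norm (v - w) \<le> R} w \<partial>lborel) =
      (\<integral>\<^sup>+ w. ?f (norm (w - v) ^ 3) \<partial>lborel)"
  proof (intro nn_integral_cong)
    fix w
    have "(norm (v - w) ^ 3) powr (\<gamma> / 3) = norm (v - w) powr \<gamma>"
      by (cases "v = w") (simp_all add: powr_powr flip: powr_numeral)
    moreover have "norm (v - w) ^ 3 \<le> R ^ 3 \<longleftrightarrow> norm (v - w) \<le> R"
      using R by simp
    ultimately show "ennreal (norm (v - w) powr \<gamma>) * indicator {w. norm (v - w) \<le> R} w =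
        ?f (norm (w - v) ^ 3)"
      by (simp add: indicator_def norm_minus_commute)
  qed
  also have "\<dots> = (\<integral>\<^sup>+ w. ?f (norm (w - v) ^ 3) \<partial>distr lborel borel ((+) v))"
    by (simp add: lborel_distr_plus)
  also have "\<dots> = (\<integral>\<^sup>+ x. ?f (norm (x::real^3) ^ 3) \<partial>lborel)"
    by (subst nn_integral_distr) simp_all
  also have "\<dots> = ennreal (4 / 3 * pi) * (\<integral>\<^sup>+ s. ?f s * indicator {0..} s \<partial>lborel)"
    using nn_integral_radial[of ?f, where 'a = "real^3"] by (simp add: unit_ball_vol_3)
  also have "(\<integral>\<^sup>+ s. ?f s * indicator {0..} s \<partial>lborel) =
      (\<integral>\<^sup>+ s. ennreal (s powr (\<gamma> / 3)) * indicator {0..R ^ 3} s \<partial>lborel)"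
    by (intro nn_integral_cong) (auto simp: indicator_def)
  also have "\<dots> = ennreal ((R ^ 3) powr (\<gamma> / 3 + 1) / (\<gamma> / 3 + 1))"
    using g R by (intro nn_integral_has_integral_lebesgue' has_integral_powr_from_0) auto
  also have "(R ^ 3) powr (\<gamma> / 3 + 1) = R powr (3 + \<gamma>)"
    using R by (simp add: powr_powr algebra_simps flip: powr_numeral)
  also have "ennreal (4 / 3 * pi) * ennreal (R powr (3 + \<gamma>) / (\<gamma> / 3 + 1)) =
      ennreal (4 * pi / (3 + \<gamma>) * R powr (3 + \<gamma>))"
    using g by (simp add: ennreal_mult[symmetric] field_simps)
  finally show ?thesis .
qed

lemma post_max_ge: "\<langle>v\<rangle>\<^sup>2 / 4 * (1 + (norm w)\<^sup>2 / \<langle>v\<rangle>\<^sup>2)\<^sup>2 \<le> post_max v w"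
proof -
  have "\<langle>v\<rangle>\<^sup>2 / 4 * (1 + (norm w)\<^sup>2 / \<langle>v\<rangle>\<^sup>2)\<^sup>2 = ((\<langle>v\<rangle>\<^sup>2 + (norm w)\<^sup>2) / 2)\<^sup>2 / \<langle>v\<rangle>\<^sup>2"
    using jbracket_pos[of v] by (simp add: field_simps power2_eq_square)
  also have "\<dots> \<le> post_max v w"
    unfolding post_max_def
    by (intro divide_right_mono power_mono) (simp_all add: jbracket_sq field_simps)
  finally show ?thesis .
qed

lemma post_max_pos: "0 < post_max v w"
  using post_min_ge_1[of v w] post_min_le_max[of v w] by linarith

text \<open>
  The coefficient of \<open>u\<^sup>2\<close> is exactly \<open>1\<close> because \<open>1 + (norm v)\<^sup>2 = \<langle>v\<rangle>\<^sup>2\<close>: in the direction of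
  \<open>v\<close> the weight lives at unit scale, transversally at scale \<open>\<langle>v\<rangle>\<close>.
\<close>
lemma post_min_cylindrical:
  assumes "norm e = 1" "v = norm v *\<^sub>R e"
  shows "post_min v w = 1 + (w \<bullet> e)\<^sup>2 + ((norm w)\<^sup>2 - (w \<bullet> e)\<^sup>2) / \<langle>v\<rangle>\<^sup>2"
proof -
  have "v \<bullet> w = norm v * (w \<bullet> e)"
    by (subst assms(2)) (simp add: inner_commute)
  then have "1 + (norm v)\<^sup>2 + (norm w)\<^sup>2 + (v \<bullet> w)\<^sup>2 =
      \<langle>v\<rangle>\<^sup>2 * (1 + (w \<bullet> e)\<^sup>2) + ((norm w)\<^sup>2 - (w \<bullet> e)\<^sup>2)"
    by (simp add: jbracket_sq power_mult_distrib algebra_simps)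
  then show ?thesis
    using jbracket_pos[of v] by (simp add: post_min_def field_simps)
qed

text \<open>
  The exponent is split as \<open>q = a + b\<close> with \<open>a > 1 / 2\<close>, enough to integrate \<open>(1 + u\<^sup>2) powr - a\<close>
  over the line, and \<open>b > 0\<close>. Since \<open>1 / post_max\<close> supplies one power of the transverse decay beyond the
  extra weight \<open>1 + (norm w)\<^sup>2 / \<langle>v\<rangle>\<^sup>2\<close>, any \<open>b > 0\<close> makes the transverse integral
  converge. This weight accounts for the growth of \<open>norm (v - w) powr \<gamma>\<close> up to \<open>\<gamma> = 2\<close>.
\<close>
lemma far_integral_bound:
  assumes q: "q > 1 / 2"
  shows "\<exists>M>0. \<forall>v. (\<integral>\<^sup>+ w. ennreal ((1 + (norm w)\<^sup>2 / \<langle>v\<rangle>\<^sup>2) * (post_min v w powr - q / post_max v w)) \<partial>lborel)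
           \<le> ennreal M"
proof -
  define a b where "a = (q + 1 / 2) / 2" and "b = (q - 1 / 2) / 2"
  have ab: "a > 1 / 2" "b > 0" "q = a + b"
    using q by (simp_all add: a_def b_def field_simps)
  define J where "J = 2 * (2 powr a / (2 * a - 1))"
  have J: "J > 0"
    using ab by (simp add: J_def)
  have "(\<integral>\<^sup>+ w. ennreal ((1 + (norm w)\<^sup>2 / \<langle>v\<rangle>\<^sup>2) * (post_min v w powr - q / post_max v w)) \<partial>lborel)
           \<le> ennreal (pi * (4 / b * J))" for v
  proof -
    define l where "l = \<langle>v\<rangle>\<^sup>2"
    have l: "l > 0"
      using jbracket_pos[of v] by (simp add: l_def)
    obtain e where e: "norm e = 1" "v = norm v *\<^sub>R e"
      using exists_direction by blast
    let ?f = "\<lambda>u t. ennreal (4 / l * (1 + u\<^sup>2) powr - a) * ennreal ((1 + 1 / l * t) powr - (1 + b))"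
    have "(\<integral>\<^sup>+ w. ennreal ((1 + (norm w)\<^sup>2 / \<langle>v\<rangle>\<^sup>2) * (post_min v w powr - q / post_max v w)) \<partial>lborel) \<le>
        (\<integral>\<^sup>+ w. ?f (w \<bullet> e) ((norm w)\<^sup>2 - (w \<bullet> e)\<^sup>2) \<partial>lborel)"
    proof (intro nn_integral_mono)
      fix w
      define u t z where "u = w \<bullet> e" and "t = (norm w)\<^sup>2 - (w \<bullet> e)\<^sup>2" and "z = 1 + (norm w)\<^sup>2 / l"
      have "\<bar>w \<bullet> e\<bar> \<le> norm w"
        using Cauchy_Schwarz_ineq2[of w e] e(1) by simp
      then have t: "0 \<le> t"
        using abs_le_square_iff[of "w \<bullet> e" "norm w"] by (simp add: t_def)
      have tz: "1 + t / l \<le> z"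
        using l by (simp add: t_def z_def divide_right_mono)
      have pos: "0 < 1 + t / l"
        using t l by (simp add: add_pos_nonneg)
      have z: "0 < z"
        using pos tz by linarith
      have min: "post_min v w = 1 + u\<^sup>2 + t / l"
        using post_min_cylindrical[OF e] by (simp add: u_def t_def l_def)
      have "post_min v w powr - q = post_min v w powr - a * post_min v w powr - b"
        by (simp add: ab(3) flip: powr_add)
      also have "\<dots> \<le> (1 + u\<^sup>2) powr - a * (1 + t / l) powr - b"
        unfolding min using t l ab pos
        by (intro mult_mono powr_mono2') (auto intro: add_pos_nonneg)
      finally have A: "post_min v w powr - q \<le> (1 + u\<^sup>2) powr - a * (1 + t / l) powr - b" .
      have "z / post_max v w \<le> z / (l / 4 * z\<^sup>2)"
      proof (rule divide_left_mono)
        show "l / 4 * z\<^sup>2 \<le> post_max v w"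
          using post_max_ge[of v w] by (simp add: l_def z_def)
        show "0 < post_max v w * (l / 4 * z\<^sup>2)"
          using l z post_max_pos[of v w] by simp
      qed (use z in simp)
      also have "\<dots> = 4 / l / z"
        using z by (simp add: power2_eq_square)
      also have "\<dots> \<le> 4 / l / (1 + t / l)"
        using tz pos l by (intro divide_left_mono) auto
      finally have B: "z / post_max v w \<le> 4 / l / (1 + t / l)" .
      have "z * (post_min v w powr - q / post_max v w) = post_min v w powr - q * (z / post_max v w)"
        by simp
      also have "\<dots> \<le> ((1 + u\<^sup>2) powr - a * (1 + t / l) powr - b) * (4 / l / (1 + t / l))"
        using A B z post_max_pos[of v w] by (intro mult_mono) auto
      also have "\<dots> = 4 / l * (1 + u\<^sup>2) powr - a * (1 + 1 / l * t) powr - (1 + b)"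
      proof -
        have "(1 + 1 / l * t) powr - (1 + b) = (1 + t / l) powr (- b - 1)"
          by (rule arg_cong2[where f = "(powr)"]) simp_all
        also have "\<dots> = (1 + t / l) powr - b / (1 + t / l)"
          using pos by (simp only: powr_diff powr_one)
        finally show ?thesis
          by simp
      qed
      finally have "z * (post_min v w powr - q / post_max v w) \<le>
          4 / l * (1 + u\<^sup>2) powr - a * (1 + 1 / l * t) powr - (1 + b)" .
      then show "ennreal ((1 + (norm w)\<^sup>2 / \<langle>v\<rangle>\<^sup>2) * (post_min v w powr - q / post_max v w)) \<le>
          ?f (w \<bullet> e) ((norm w)\<^sup>2 - (w \<bullet> e)\<^sup>2)"
        using l by (simp add: ennreal_mult[symmetric] ennreal_leI z_def u_def t_def l_def)
    qed
    also have "\<dots> = ennreal pi * (\<integral>\<^sup>+ u. \<integral>\<^sup>+ t. ?f u t * indicator {0..} t \<partial>lborel \<partial>lborel)"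
      by (rule nn_integral_cylindrical[OF e(1)]) (simp add: borel_prod[symmetric])
    also have "(\<integral>\<^sup>+ u. \<integral>\<^sup>+ t. ?f u t * indicator {0..} t \<partial>lborel \<partial>lborel) =
        (\<integral>\<^sup>+ u. ennreal (4 / b) * ennreal ((1 + u\<^sup>2) powr - a) \<partial>lborel)"
    proof (intro nn_integral_cong)
      fix u :: real
      have "(\<integral>\<^sup>+ t. ?f u t * indicator {0..} t \<partial>lborel) =
          ennreal (4 / l * (1 + u\<^sup>2) powr - a) *
            (\<integral>\<^sup>+ t. ennreal ((1 + 1 / l * t) powr - (1 + b)) * indicator {0..} t \<partial>lborel)"
        unfolding mult.assoc by (intro nn_integral_cmult) simp
      also have "\<dots> = ennreal (4 / l * (1 + u\<^sup>2) powr - a) * ennreal (l / b)"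
        using ab l by (subst nn_integral_powr_tail) simp_all
      also have "\<dots> = ennreal (4 / b) * ennreal ((1 + u\<^sup>2) powr - a)"
        using ab l by (simp add: ennreal_mult[symmetric])
      finally show "(\<integral>\<^sup>+ t. ?f u t * indicator {0..} t \<partial>lborel) = ennreal (4 / b) * ennreal ((1 + u\<^sup>2) powr - a)" .
    qed
    also have "\<dots> = ennreal (4 / b) * (\<integral>\<^sup>+ u. ennreal ((1 + u\<^sup>2) powr - a) \<partial>lborel)"
      by (intro nn_integral_cmult) simp
    also have "ennreal pi * \<dots> \<le> ennreal pi * (ennreal (4 / b) * ennreal J)"
      unfolding J_def by (intro mult_left_mono nn_integral_japanese_line ab) simp_all
    also have "\<dots> = ennreal (pi * (4 / b * J))"
      using ab J by (simp add: ennreal_mult[symmetric])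
    finally show ?thesis .
  qed
  then show ?thesis
    using ab J by (intro exI[of _ "pi * (4 / b * J)"]) auto
qed

lemma relative_speed_powr_le:
  assumes "\<gamma> \<le> 2" and "0 \<le> \<gamma> \<or> -3 < \<gamma> \<and> \<langle>v\<rangle> / 4 < norm (v - w)"
  shows "norm (v - w) powr \<gamma> \<le> 64 * \<langle>v\<rangle> powr \<gamma> * (1 + (norm w)\<^sup>2 / \<langle>v\<rangle>\<^sup>2)"
proof -
  have L: "0 < \<langle>v\<rangle>"
    by (rule jbracket_pos)
  show ?thesis
  proof (cases "0 \<le> \<gamma>")
    case True
    define r where "r = norm w / \<langle>v\<rangle>"
    have r: "0 \<le> r"
      using L by (simp add: r_def)
    have "norm (v - w) \<le> \<langle>v\<rangle> + norm w"
      using norm_triangle_ineq4[of v w] jbracket_ge_norm[of v] by linarith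
    also have "\<dots> = \<langle>v\<rangle> * (1 + r)"
      using L by (simp add: r_def field_simps)
    finally have "norm (v - w) powr \<gamma> \<le> (\<langle>v\<rangle> * (1 + r)) powr \<gamma>"
      using True by (intro powr_mono2) auto
    also have "\<dots> = \<langle>v\<rangle> powr \<gamma> * (1 + r) powr \<gamma>"
      using L r by (simp add: powr_mult)
    also have "(1 + r) powr \<gamma> \<le> (1 + r) powr 2"
      using r assms(1) by (intro powr_mono) auto
    also have "(1 + r) powr 2 = (1 + r)\<^sup>2"
      using r by simp
    also have "(1 + r)\<^sup>2 \<le> 64 * (1 + r\<^sup>2)"
    proof -
      have "(1 + r)\<^sup>2 \<le> 2 * (1 + r\<^sup>2)"
        using sum_squares_bound[of 1 r] by (simp add: power2_sum)
      also have "\<dots> \<le> 64 * (1 + r\<^sup>2)"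
        by (intro mult_right_mono) auto
      finally show ?thesis .
    qed
    finally show ?thesis
      using L by (simp add: r_def power_divide mult_ac)
  next
    case False
    then have *: "-3 < \<gamma>" "\<langle>v\<rangle> / 4 < norm (v - w)"
      using assms by auto
    have "norm (v - w) powr \<gamma> \<le> (\<langle>v\<rangle> / 4) powr \<gamma>"
      using * False L by (intro powr_mono2') auto
    also have "\<dots> = 4 powr - \<gamma> * \<langle>v\<rangle> powr \<gamma>"
      using L by (simp add: powr_divide powr_minus_divide)
    also have "\<dots> \<le> 4 powr 3 * \<langle>v\<rangle> powr \<gamma>"
      using * by (intro mult_right_mono powr_mono) auto
    also have "\<dots> = 64 * \<langle>v\<rangle> powr \<gamma> * 1"
      by simp
    also have "\<dots> \<le> 64 * \<langle>v\<rangle> powr \<gamma> * (1 + (norm w)\<^sup>2 / \<langle>v\<rangle>\<^sup>2)"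
      by (rule mult_left_mono) simp_all
    finally show ?thesis .
  qed
qed

text \<open>
  Near \<open>v\<close> the component of \<open>w\<close> along \<open>v\<close> is of size \<open>\<langle>v\<rangle>\<close>, unless \<open>v\<close> itself is so small
  that \<open>\<langle>v\<rangle>\<^sup>2 / 64 \<le> 1\<close>.
\<close>
lemma post_min_near:
  assumes near: "norm (v - w) \<le> \<langle>v\<rangle> / 4"
  shows "\<langle>v\<rangle>\<^sup>2 / 64 \<le> post_min v w"
proof (cases "\<langle>v\<rangle> / 2 \<le> norm v")
  case True
  have L: "0 < \<langle>v\<rangle>"
    by (rule jbracket_pos)
  have "v \<bullet> (v - w) \<le> norm v * (\<langle>v\<rangle> / 4)"
    using norm_cauchy_schwarz[of v "v - w"] mult_left_mono[OF near, of "norm v"] by simp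
  then have "norm v * norm v - norm v * (\<langle>v\<rangle> / 4) \<le> v \<bullet> w"
    by (simp add: inner_diff_right dot_square_norm power2_eq_square)
  moreover have "\<langle>v\<rangle> / 2 * (\<langle>v\<rangle> / 4) \<le> norm v * (norm v - \<langle>v\<rangle> / 4)"
    using True L by (intro mult_mono) auto
  ultimately have "\<langle>v\<rangle>\<^sup>2 / 8 \<le> v \<bullet> w"
    by (simp add: power2_eq_square algebra_simps)
  then have "(\<langle>v\<rangle>\<^sup>2 / 8)\<^sup>2 \<le> (v \<bullet> w)\<^sup>2"
    by (intro power_mono) auto
  then have "(\<langle>v\<rangle>\<^sup>2 / 8)\<^sup>2 / \<langle>v\<rangle>\<^sup>2 \<le> post_min v w"
    unfolding post_min_def by (intro divide_right_mono) (auto intro: add_nonneg_nonneg order_trans)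
  moreover have "(\<langle>v\<rangle>\<^sup>2 / 8)\<^sup>2 / \<langle>v\<rangle>\<^sup>2 = \<langle>v\<rangle>\<^sup>2 / 64"
    using L by (simp add: power2_eq_square)
  ultimately show ?thesis
    by simp
next
  case False
  then have "(norm v)\<^sup>2 \<le> (\<langle>v\<rangle> / 2)\<^sup>2"
    by (intro power_mono) auto
  then have "\<langle>v\<rangle>\<^sup>2 / 64 \<le> 1"
    using jbracket_sq[of v] by (simp add: power_divide)
  then show ?thesis
    using post_min_ge_1[of v w] by linarith
qed

text \<open>
  The exponent \<open>q \<ge> 1 / 2\<close> turns \<open>post_min\<close> of order \<open>\<langle>v\<rangle>\<^sup>2\<close> into a gain of one power
  of \<open>\<langle>v\<rangle>\<close>. Together with the two powers from \<open>post_max\<close> this compensates the volume of the ball.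
\<close>
lemma near_weight_le:
  assumes near: "norm (v - w) \<le> \<langle>v\<rangle> / 4" and q: "1 / 2 \<le> q"
  shows "post_min v w powr - q / post_max v w \<le> 32 / \<langle>v\<rangle> ^ 3"
proof -
  have L: "0 < \<langle>v\<rangle>"
    by (rule jbracket_pos)
  have "post_min v w powr - q \<le> post_min v w powr - (1 / 2)"
    using post_min_ge_1[of v w] q by (intro powr_mono) auto
  also have "\<dots> \<le> (\<langle>v\<rangle>\<^sup>2 / 64) powr - (1 / 2)"
    using post_min_near[OF near] L by (intro powr_mono2') auto
  also have "\<dots> = 8 / \<langle>v\<rangle>"
  proof -
    have "\<langle>v\<rangle>\<^sup>2 / 64 = (\<langle>v\<rangle> / 8)\<^sup>2"
      by (simp add: power_divide)
    then show ?thesis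
      using L by (simp add: powr_minus powr_half_sqrt)
  qed
  finally have A: "post_min v w powr - q \<le> 8 / \<langle>v\<rangle>" .
  have "\<langle>v\<rangle>\<^sup>2 / 4 * 1 \<le> \<langle>v\<rangle>\<^sup>2 / 4 * (1 + (norm w)\<^sup>2 / \<langle>v\<rangle>\<^sup>2)\<^sup>2"
    by (intro mult_left_mono) (auto simp: one_le_power)
  then have B: "\<langle>v\<rangle>\<^sup>2 / 4 \<le> post_max v w"
    using post_max_ge[of v w] by linarith
  have "post_min v w powr - q / post_max v w \<le> 8 / \<langle>v\<rangle> / (\<langle>v\<rangle>\<^sup>2 / 4)"
    using A B L by (intro frac_le) auto
  also have "\<dots> = 32 / \<langle>v\<rangle> ^ 3"
    by (simp add: power2_eq_square power3_eq_cube)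
  finally show ?thesis .
qed

text \<open>
  The constant does not depend on \<open>\<gamma>\<close>; the refined estimate needs this uniformity.
\<close>
lemma weighted_integral_nonneg_exponent:
  assumes q: "q > 1 / 2"
  shows "\<exists>C>0. \<forall>\<gamma> v. 0 \<le> \<gamma> \<and> \<gamma> \<le> 2 \<longrightarrow>
    (\<integral>\<^sup>+ w. ennreal (norm (v - w) powr \<gamma> * (post_min v w powr - q / post_max v w)) \<partial>lborel)
      \<le> ennreal (C * \<langle>v\<rangle> powr \<gamma>)"
proof -
  obtain M where M: "M > 0" "\<And>v. (\<integral>\<^sup>+ w. ennreal ((1 + (norm w)\<^sup>2 / \<langle>v\<rangle>\<^sup>2) *
      (post_min v w powr - q / post_max v w)) \<partial>lborel) \<le> ennreal M"
    using far_integral_bound[OF q] by blast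
  have "(\<integral>\<^sup>+ w. ennreal (norm (v - w) powr \<gamma> * (post_min v w powr - q / post_max v w)) \<partial>lborel)
      \<le> ennreal (64 * M * \<langle>v\<rangle> powr \<gamma>)" if \<gamma>: "0 \<le> \<gamma>" "\<gamma> \<le> 2" for \<gamma> v
  proof -
    have "(\<integral>\<^sup>+ w. ennreal (norm (v - w) powr \<gamma> * (post_min v w powr - q / post_max v w)) \<partial>lborel) \<le>
        (\<integral>\<^sup>+ w. ennreal (64 * \<langle>v\<rangle> powr \<gamma>) * ennreal ((1 + (norm w)\<^sup>2 / \<langle>v\<rangle>\<^sup>2) *
          (post_min v w powr - q / post_max v w)) \<partial>lborel)"
    proof (intro nn_integral_mono)
      fix w
      have "norm (v - w) powr \<gamma> * (post_min v w powr - q / post_max v w) \<le>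
          64 * \<langle>v\<rangle> powr \<gamma> * (1 + (norm w)\<^sup>2 / \<langle>v\<rangle>\<^sup>2) * (post_min v w powr - q / post_max v w)"
        using relative_speed_powr_le[of \<gamma> v w] \<gamma> post_max_pos[of v w]
        by (intro mult_right_mono) auto
      then show "ennreal (norm (v - w) powr \<gamma> * (post_min v w powr - q / post_max v w)) \<le>
          ennreal (64 * \<langle>v\<rangle> powr \<gamma>) * ennreal ((1 + (norm w)\<^sup>2 / \<langle>v\<rangle>\<^sup>2) *
          (post_min v w powr - q / post_max v w))"
        using post_max_pos[of v w] by (subst ennreal_mult[symmetric]) (auto simp: ennreal_leI mult.assoc)
    qed
    also have "\<dots> = ennreal (64 * \<langle>v\<rangle> powr \<gamma>) * (\<integral>\<^sup>+ w. ennreal ((1 + (norm w)\<^sup>2 / \<langle>v\<rangle>\<^sup>2) *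
          (post_min v w powr - q / post_max v w)) \<partial>lborel)"
      by (intro nn_integral_cmult) (simp add: post_min_def post_max_def)
    also have "\<dots> \<le> ennreal (64 * \<langle>v\<rangle> powr \<gamma>) * ennreal M"
      by (intro mult_left_mono M) simp
    also have "\<dots> = ennreal (64 * M * \<langle>v\<rangle> powr \<gamma>)"
      using M(1) by (simp add: ennreal_mult[symmetric] mult_ac)
    finally show ?thesis .
  qed
  then show ?thesis
    using M(1) by (intro exI[of _ "64 * M"]) auto
qed

lemma weighted_integral_neg_exponent:
  assumes q: "q > 1 / 2" and \<gamma>: "-3 < \<gamma>" "\<gamma> < 0"
  shows "\<exists>C>0. \<forall>v.
    (\<integral>\<^sup>+ w. ennreal (norm (v - w) powr \<gamma> * (post_min v w powr - q / post_max v w)) \<partial>lborel)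
      \<le> ennreal (C * \<langle>v\<rangle> powr \<gamma>)"
proof -
  obtain M where M: "M > 0" "\<And>v. (\<integral>\<^sup>+ w. ennreal ((1 + (norm w)\<^sup>2 / \<langle>v\<rangle>\<^sup>2) *
      (post_min v w powr - q / post_max v w)) \<partial>lborel) \<le> ennreal M"
    using far_integral_bound[OF q] by blast
  define N where "N = 128 * pi / (3 + \<gamma>)"
  have N: "N > 0"
    using \<gamma> by (simp add: N_def)
  have "(\<integral>\<^sup>+ w. ennreal (norm (v - w) powr \<gamma> * (post_min v w powr - q / post_max v w)) \<partial>lborel)
      \<le> ennreal ((64 * M + N) * \<langle>v\<rangle> powr \<gamma>)" for v
  proof -
    have L: "0 < \<langle>v\<rangle>"
      by (rule jbracket_pos)
    let ?H = "\<lambda>w. ennreal ((1 + (norm w)\<^sup>2 / \<langle>v\<rangle>\<^sup>2) * (post_min v w powr - q / post_max v w))"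
    let ?B = "{w. norm (v - w) \<le> \<langle>v\<rangle> / 4}"
    have "(\<integral>\<^sup>+ w. ennreal (norm (v - w) powr \<gamma> * (post_min v w powr - q / post_max v w)) \<partial>lborel) \<le>
        (\<integral>\<^sup>+ w. ennreal (64 * \<langle>v\<rangle> powr \<gamma>) * ?H w +
          ennreal (32 / \<langle>v\<rangle> ^ 3) * (ennreal (norm (v - w) powr \<gamma>) * indicator ?B w) \<partial>lborel)"
    proof (intro nn_integral_mono)
      fix w
      let ?G = "ennreal (norm (v - w) powr \<gamma> * (post_min v w powr - q / post_max v w))"
      show "?G \<le> ennreal (64 * \<langle>v\<rangle> powr \<gamma>) * ?H w +
          ennreal (32 / \<langle>v\<rangle> ^ 3) * (ennreal (norm (v - w) powr \<gamma>) * indicator ?B w)"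
      proof (cases "w \<in> ?B")
        case True
        then have "norm (v - w) powr \<gamma> * (post_min v w powr - q / post_max v w) \<le>
            norm (v - w) powr \<gamma> * (32 / \<langle>v\<rangle> ^ 3)"
          using near_weight_le[of v w q] q by (intro mult_left_mono) auto
        then have "?G \<le> ennreal (32 / \<langle>v\<rangle> ^ 3 * norm (v - w) powr \<gamma>)"
          by (intro ennreal_leI) (simp add: mult.commute)
        also have "\<dots> = ennreal (32 / \<langle>v\<rangle> ^ 3) * ennreal (norm (v - w) powr \<gamma>)"
          using L by (intro ennreal_mult) auto
        also have "\<dots> = ennreal (32 / \<langle>v\<rangle> ^ 3) * (ennreal (norm (v - w) powr \<gamma>) * indicator ?B w)"
          using True by simp
        finally show ?thesis
          by (rule order_trans) (rule add_increasing[OF zero_le order_refl])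
      next
        case False
        then have "norm (v - w) powr \<gamma> * (post_min v w powr - q / post_max v w) \<le>
            64 * \<langle>v\<rangle> powr \<gamma> * (1 + (norm w)\<^sup>2 / \<langle>v\<rangle>\<^sup>2) * (post_min v w powr - q / post_max v w)"
          using relative_speed_powr_le[of \<gamma> v w] \<gamma> post_max_pos[of v w]
          by (intro mult_right_mono) auto
        then have "?G \<le> ennreal (64 * \<langle>v\<rangle> powr \<gamma>) * ?H w"
          using post_max_pos[of v w] by (subst ennreal_mult[symmetric]) (auto simp: ennreal_leI mult.assoc)
        then show ?thesis
          by (rule order_trans) (rule add_increasing2[OF zero_le order_refl])
      qed
    qed
    also have "\<dots> = ennreal (64 * \<langle>v\<rangle> powr \<gamma>) * (\<integral>\<^sup>+ w. ?H w \<partial>lborel) +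
        ennreal (32 / \<langle>v\<rangle> ^ 3) * (\<integral>\<^sup>+ w. ennreal (norm (v - w) powr \<gamma>) * indicator ?B w \<partial>lborel)"
    proof -
      have [measurable]: "?B \<in> sets borel"
        by (intro borel_closed closed_Collect_le continuous_intros)
      then have "(\<lambda>w. ennreal (norm (v - w) powr \<gamma>) * indicator ?B w) \<in> borel_measurable lborel"
        by measurable
      moreover have "?H \<in> borel_measurable lborel"
        by (simp add: post_min_def post_max_def)
      ultimately show ?thesis
        by (simp only: nn_integral_add nn_integral_cmult borel_measurable_times_ennreal
            borel_measurable_const)
    qed
    also have "\<dots> \<le> ennreal (64 * \<langle>v\<rangle> powr \<gamma>) * ennreal M +
        ennreal (32 / \<langle>v\<rangle> ^ 3) * ennreal (4 * pi / (3 + \<gamma>) * (\<langle>v\<rangle> / 4) powr (3 + \<gamma>))"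
    proof -
      have "(\<integral>\<^sup>+ w. ennreal (norm (v - w) powr \<gamma>) * indicator ?B w \<partial>lborel) =
          ennreal (4 * pi / (3 + \<gamma>) * (\<langle>v\<rangle> / 4) powr (3 + \<gamma>))"
        using L \<gamma> by (intro nn_integral_norm_powr_ball) auto
      then show ?thesis
        by (simp only: add_right_mono mult_left_mono M zero_le)
    qed
    also have "\<dots> = ennreal (64 * \<langle>v\<rangle> powr \<gamma> * M +
        32 / \<langle>v\<rangle> ^ 3 * (4 * pi / (3 + \<gamma>) * (\<langle>v\<rangle> / 4) powr (3 + \<gamma>)))"
      using L \<gamma> M(1) by (simp add: ennreal_mult[symmetric] ennreal_plus[symmetric] del: ennreal_plus)
    also have "\<dots> \<le> ennreal ((64 * M + N) * \<langle>v\<rangle> powr \<gamma>)"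
    proof (intro ennreal_leI)
      have "(\<langle>v\<rangle> / 4) powr (3 + \<gamma>) \<le> \<langle>v\<rangle> powr (3 + \<gamma>)"
        using L \<gamma> by (intro powr_mono2) auto
      also have "\<dots> = \<langle>v\<rangle> ^ 3 * \<langle>v\<rangle> powr \<gamma>"
        using L by (simp add: powr_add)
      finally have "32 / \<langle>v\<rangle> ^ 3 * (4 * pi / (3 + \<gamma>) * (\<langle>v\<rangle> / 4) powr (3 + \<gamma>)) \<le>
          32 / \<langle>v\<rangle> ^ 3 * (4 * pi / (3 + \<gamma>) * (\<langle>v\<rangle> ^ 3 * \<langle>v\<rangle> powr \<gamma>))"
        using L \<gamma> by (intro mult_left_mono) auto
      also have "\<dots> = N * \<langle>v\<rangle> powr \<gamma>"
        using L by (simp add: N_def)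
      finally show "64 * \<langle>v\<rangle> powr \<gamma> * M +
        32 / \<langle>v\<rangle> ^ 3 * (4 * pi / (3 + \<gamma>) * (\<langle>v\<rangle> / 4) powr (3 + \<gamma>)) \<le> (64 * M + N) * \<langle>v\<rangle> powr \<gamma>"
        by (simp add: algebra_simps)
    qed
    finally show ?thesis .
  qed
  then show ?thesis
    using M(1) N by (intro exI[of _ "64 * M + N"]) auto
qed


section \<open>The weighted collision estimate\<close>

theorem lemma2p11:
  shows "(\<forall>\<gamma> k::real. -3 < \<gamma> \<and> \<gamma> \<le> 2 \<and> k > max 3 (3 + \<gamma>) \<longrightarrow>
            (\<exists>C>0. \<forall>v. collision_integral \<gamma> k v \<le> ennreal (C * \<langle>v\<rangle> powr \<gamma>)))
       \<and> (\<forall>k\<^sub>0::real. k\<^sub>0 > 3 \<longrightarrow>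
            (\<exists>c>0. \<forall>\<gamma> k::real. 0 \<le> \<gamma> \<and> \<gamma> \<le> 1 \<and> k > max 3 (3 + \<gamma>) \<and> k \<ge> k\<^sub>0 \<longrightarrow>
              (\<exists>C>0. \<forall>v. collision_integral \<gamma> k v
                 \<le> ennreal (c / k * \<langle>v\<rangle> powr \<gamma> + C * \<langle>v\<rangle> powr (\<gamma> - 2)))))"
proof -
  have first: "\<exists>C>0. \<forall>v. collision_integral \<gamma> k v \<le> ennreal (C * \<langle>v\<rangle> powr \<gamma>)"
    if \<gamma>: "-3 < \<gamma>" "\<gamma> \<le> 2" and k: "k > 3" for \<gamma> k :: real
  proof -
    define q K where "q = k / 2 - 1" and "K = 12 * pi * (1 + 1 / (k / 2 - 1))"
    have q: "q > 1 / 2" and K: "K > 0"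
      using k by (simp_all add: q_def K_def add_pos_pos)
    have "\<exists>D>0. \<forall>v. (\<integral>\<^sup>+ w. ennreal (norm (v - w) powr \<gamma> * (post_min v w powr - q / post_max v w)) \<partial>lborel)
        \<le> ennreal (D * \<langle>v\<rangle> powr \<gamma>)"
      using weighted_integral_nonneg_exponent[OF q] weighted_integral_neg_exponent[OF q \<gamma>(1)] \<gamma>(2)
      by (cases "0 \<le> \<gamma>") (blast, force)
    then obtain D where D: "D > 0" "\<And>v. (\<integral>\<^sup>+ w. ennreal (norm (v - w) powr \<gamma> *
        (post_min v w powr - q / post_max v w)) \<partial>lborel) \<le> ennreal (D * \<langle>v\<rangle> powr \<gamma>)"
      by blast
    have "collision_integral \<gamma> k v \<le> ennreal (K * D * \<langle>v\<rangle> powr \<gamma>)" for v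
    proof -
      have "collision_integral \<gamma> k v \<le> ennreal K *
          (\<integral>\<^sup>+ w. ennreal (norm (v - w) powr \<gamma> * (post_min v w powr - q / post_max v w)) \<partial>lborel)"
      proof (rule collision_integral_le)
        fix w e :: "real^3" assume e: "norm e = 1"
        have "0 < post_min v w"
          using post_min_ge_1[of v w] by linarith
        from sphere_kernel_bound_max[OF e this post_min_le_max, of "k / 2"]
        show "(\<integral>\<^sup>+ \<sigma>. ennreal ((post_min v w + (post_max v w - post_min v w) * (1 - (\<sigma> \<bullet> e)\<^sup>2)) powr - (k / 2))
            \<partial>sphere_measure) \<le> ennreal (K * (post_min v w powr - q / post_max v w))"
          using k by (simp add: q_def K_def)
      qed (use K in simp)
      also have "\<dots> \<le> ennreal K * ennreal (D * \<langle>v\<rangle> powr \<gamma>)"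
        by (rule mult_left_mono[OF D(2)]) simp
      also have "\<dots> = ennreal (K * D * \<langle>v\<rangle> powr \<gamma>)"
        using K D(1) by (simp add: ennreal_mult[symmetric] mult.assoc)
      finally show ?thesis .
    qed
    then show ?thesis
      using K D(1) by (intro exI[of _ "K * D"]) auto
  qed
  have second: "\<exists>c>0. \<forall>\<gamma> k::real. 0 \<le> \<gamma> \<and> \<gamma> \<le> 1 \<and> k > max 3 (3 + \<gamma>) \<and> k \<ge> k\<^sub>0 \<longrightarrow>
              (\<exists>C>0. \<forall>v. collision_integral \<gamma> k v
                 \<le> ennreal (c / k * \<langle>v\<rangle> powr \<gamma> + C * \<langle>v\<rangle> powr (\<gamma> - 2)))"
    if k\<^sub>0: "k\<^sub>0 > 3" for k\<^sub>0 :: real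
  proof -
    define p\<^sub>0 q where "p\<^sub>0 = k\<^sub>0 / 2" and "q = k\<^sub>0 / 2 - 1"
    have p\<^sub>0: "1 < p\<^sub>0" and q: "q > 1 / 2"
      using k\<^sub>0 by (simp_all add: p\<^sub>0_def q_def)
    define K where "K = 16 * pi * p\<^sub>0 * (1 + 1 / (p\<^sub>0 - 1))"
    have K: "K > 0"
      using p\<^sub>0 by (simp add: K_def add_pos_pos)
    obtain D where D: "D > 0" "\<And>\<gamma> v. 0 \<le> \<gamma> \<Longrightarrow> \<gamma> \<le> 2 \<Longrightarrow> (\<integral>\<^sup>+ w. ennreal (norm (v - w) powr \<gamma> *
        (post_min v w powr - q / post_max v w)) \<partial>lborel) \<le> ennreal (D * \<langle>v\<rangle> powr \<gamma>)"
      using weighted_integral_nonneg_exponent[OF q] by blast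
    \<comment> \<open>The sphere bound is applied with \<open>p = k / 2\<close>, hence the factor 2.\<close>
    have large: "collision_integral \<gamma> k v \<le> ennreal (2 * K * D / k * \<langle>v\<rangle> powr \<gamma>)"
      if \<gamma>: "0 \<le> \<gamma>" "\<gamma> \<le> 1" and k: "k\<^sub>0 \<le> k" and v: "4 \<le> \<langle>v\<rangle>" for \<gamma> k v
    proof -
      have k_pos: "0 < k"
        using k k\<^sub>0 by simp
      have "collision_integral \<gamma> k v \<le> ennreal (2 * K / k) *
          (\<integral>\<^sup>+ w. ennreal (norm (v - w) powr \<gamma> * (post_min v w powr - q / post_max v w)) \<partial>lborel)"
      proof (rule collision_integral_le)
        fix w e :: "real^3" assume e: "norm e = 1"
        have "4 \<le> \<langle>v\<rangle>\<^sup>2 / 4"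
          using power_mono[OF v, of 2] by simp
        also have "\<dots> = \<langle>v\<rangle>\<^sup>2 / 4 * 1"
          by simp
        also have "\<dots> \<le> \<langle>v\<rangle>\<^sup>2 / 4 * (1 + (norm w)\<^sup>2 / \<langle>v\<rangle>\<^sup>2)\<^sup>2"
          by (intro mult_left_mono) (auto simp: one_le_power)
        also have "\<dots> \<le> post_max v w"
          by (rule post_max_ge)
        finally have "4 \<le> post_max v w" .
        from sphere_kernel_bound_uniform[OF e post_min_ge_1 post_min_le_max this p\<^sub>0, of "k / 2"]
        show "(\<integral>\<^sup>+ \<sigma>. ennreal ((post_min v w + (post_max v w - post_min v w) * (1 - (\<sigma> \<bullet> e)\<^sup>2)) powr - (k / 2))
            \<partial>sphere_measure) \<le> ennreal (2 * K / k * (post_min v w powr - q / post_max v w))"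
          using k by (simp add: p\<^sub>0_def q_def K_def mult_ac)
      qed (use K k_pos in simp)
      also have "\<dots> \<le> ennreal (2 * K / k) * ennreal (D * \<langle>v\<rangle> powr \<gamma>)"
        using \<gamma> by (intro mult_left_mono D(2)) auto
      also have "\<dots> = ennreal (2 * K * D / k * \<langle>v\<rangle> powr \<gamma>)"
        using K D(1) k_pos by (simp add: ennreal_mult[symmetric])
      finally show ?thesis .
    qed
    show ?thesis
    proof (rule exI[of _ "2 * K * D"], intro conjI allI impI)
      fix \<gamma> k :: real
      assume *: "0 \<le> \<gamma> \<and> \<gamma> \<le> 1 \<and> k > max 3 (3 + \<gamma>) \<and> k \<ge> k\<^sub>0"
      then obtain C where C: "C > 0" "\<And>v. collision_integral \<gamma> k v \<le> ennreal (C * \<langle>v\<rangle> powr \<gamma>)"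
        using first[of \<gamma> k] by auto
      have "collision_integral \<gamma> k v \<le>
          ennreal (2 * K * D / k * \<langle>v\<rangle> powr \<gamma> + 16 * C * \<langle>v\<rangle> powr (\<gamma> - 2))" for v
      proof (cases "4 \<le> \<langle>v\<rangle>")
        case True
        then have "collision_integral \<gamma> k v \<le> ennreal (2 * K * D / k * \<langle>v\<rangle> powr \<gamma>)"
          using * large by blast
        also have "\<dots> \<le> ennreal (2 * K * D / k * \<langle>v\<rangle> powr \<gamma> + 16 * C * \<langle>v\<rangle> powr (\<gamma> - 2))"
          using C(1) by (intro ennreal_leI) simp
        finally show ?thesis .
      next
        case False
        \<comment> \<open>For bounded \<open>v\<close> the two powers differ by the bounded factor \<open>\<langle>v\<rangle>\<^sup>2 < 16\<close>.\<close>
        have "\<langle>v\<rangle> powr \<gamma> = \<langle>v\<rangle>\<^sup>2 * \<langle>v\<rangle> powr (\<gamma> - 2)"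
          using jbracket_pos[of v] by (simp add: powr_diff)
        also have "\<dots> \<le> 4\<^sup>2 * \<langle>v\<rangle> powr (\<gamma> - 2)"
          using False jbracket_pos[of v] by (intro mult_right_mono power_mono) auto
        finally have "C * \<langle>v\<rangle> powr \<gamma> \<le> C * (16 * \<langle>v\<rangle> powr (\<gamma> - 2))"
          using C(1) by simp
        also have "\<dots> \<le> 2 * K * D / k * \<langle>v\<rangle> powr \<gamma> + 16 * C * \<langle>v\<rangle> powr (\<gamma> - 2)"
          using K D(1) * by simp
        finally show ?thesis
          using C(2)[of v] by (auto intro: order_trans ennreal_leI)
      qed
      then show "\<exists>C>0. \<forall>v. collision_integral \<gamma> k v
                 \<le> ennreal (2 * K * D / k * \<langle>v\<rangle> powr \<gamma> + C * \<langle>v\<rangle> powr (\<gamma> - 2))"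
        using C(1) by (intro exI[of _ "16 * C"]) auto
    qed (use K D(1) in simp)
  qed
  show ?thesis
    using first second by auto
qed

end
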